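(* Let $\Theta_L$ be a minimal $L$-system with one-dimensional input-output space $\mathbb C$ and $J=1$, let $\alpha\in[0,\pi)$, let $\Theta_{0,\alpha}$ be the controller corresponding to $\alpha$, and let $$\Theta_{LF}=\Theta_L\cdot\Theta_{0,\alpha}$$ be the $LF$-coupling of $\Theta_L$ and $\Theta_{0,\alpha}$. Then $\Theta_{LF}$ is equivalent to a unimodular transformation $\Theta_\alpha$ of $\Theta_L$ for the same value of $\alpha$, and hence $W_{\Theta_{LF}}(z)=W_{\Theta_\alpha}(z)$ on the intersection of their domains of definition.
   Context: $[X,Y]$ denotes the bounded linear operators from $X$ to $Y$; $\mathrm{Im}\,S=(S-S^* )/(2i)$, $\mathrm{Re}\,S=(S+S^* )/2$. **$L$-system with one-dimensional input-output.** Let $\dot A$ be a closed, densely defined symmetric operator with finite equal deficiency indices in a Hilbert space $\mathcal H_1$. Let $\mathcal H_{+1}=\mathrm{Dom}(\dot A^* )$ with inner product $(f,g)_+=(f,g)+(\dot A^*f,\dot A^*g)$, and let $\mathcal H_{+1}\subset\mathcal H_1\subset\mathcal H_{-1}$ be the corresponding rigged Hilbert space ($\mathcal H_{-1}$ dual to $\mathcal H_{+1}$ with respect to the pairing extending the inner product of $\mathcal H_1$), with the conjugate of $\mathcal H_{\pm1}$ identified with $\mathcal H_{\mp1}$. A quasi-self-adjoint extension of $\dot A$ is a non-symmetric operator $T$ with $\dot A\subset T\subset\dot A^*$; it belongs to $\Lambda(\dot A)$ if $\rho(T)\ne\emptyset$ and $\mathrm{Dom}(\dot A)=\mathrm{Dom}(T)\cap\mathrm{Dom}(T^*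 )$. An operator $\mathbb A\in[\mathcal H_{+1},\mathcal H_{-1}]$ is a $( * )$-extension of $T$ if $\mathbb A\supset T\supset\dot A$, $\mathbb A^*\supset T^*\supset\dot A$, and the quasi-kernel $\hat A$ of $\mathrm{Re}\,\mathbb A$, i.e. the restriction of $\mathrm{Re}\,\mathbb A$ to $\{f\in\mathcal H_{+1}:\mathrm{Re}\,\mathbb A f\in\mathcal H_1\}$, is self-adjoint in $\mathcal H_1$. An $L$-system with $E=\mathbb C$, $J=1$, $$\Theta_L=\begin{pmatrix}\mathbb A&K_1&1\\ \mathcal H_{+1}\subset\mathcal H_1\subset\mathcal H_{-1}&&\mathbb C\end{pmatrix},$$ consists of a $( * )$-extension $\mathbb A$ of some $T\in\Lambda(\dot A)$ (the main operator) and $K_1\in[\mathbb C,\mathcal H_{-1}]$ with $\mathrm{Im}\,\mathbb A=K_1K_1^*$ and $\mathrm{Ran}(K_1)=\mathrm{Ran}(\mathrm{Im}\,\mathbb A)$. It is minimal if $\dot A$ is prime, i.e. there is no non-trivial reducing subspace of $\mathcal H_1$ on which $\dot A$ induces a self-adjoint operator. Its transfer function is $W_{\Theta_L}(z)=1-2iK_1^*(\mathbb A-zI)^{-1}K_1$, $z\in\rho(T)$ (known to be well defined: $(\mathbb A-zI)x=K_1e$ is uniquely solvable in $\mathcal H_{+1}$). **Unimodular transformation.** For $\alpha\in[0,\pi)$, an $L$-system with $E=\mathbb C$, $J=1$, $$\Theta_\alpha=\begin{pmatrix}\mathbb A_\alpha&K_\alpha&1\\ \mathcal H_+^{(\alpha)}\subset\mathcal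 H^{(\alpha)}\subset\mathcal H_-^{(\alpha)}&&\mathbb C\end{pmatrix}$$ (that is, $\mathcal H_+^{(\alpha)}\subset\mathcal H^{(\alpha)}\subset\mathcal H_-^{(\alpha)}$ is the rigged Hilbert space with $\mathcal H_+^{(\alpha)}=\mathrm{Dom}(\dot A_\alpha^* )$ for a closed, densely defined symmetric operator $\dot A_\alpha$ with finite equal deficiency indices in $\mathcal H^{(\alpha)}$, $\mathbb A_\alpha$ is a $( * )$-extension of some $T_\alpha\in\Lambda(\dot A_\alpha)$, and $K_\alpha\in[\mathbb C,\mathcal H_-^{(\alpha)}]$ with $\mathrm{Im}\,\mathbb A_\alpha=K_\alpha K_\alpha^*$ and $\mathrm{Ran}(K_\alpha)=\mathrm{Ran}(\mathrm{Im}\,\mathbb A_\alpha)$), with transfer function $W_{\Theta_\alpha}(z)=1-2iK_\alpha^*(\mathbb A_\alpha-zI)^{-1}K_\alpha$, $z\in\rho(T_\alpha)$, is a unimodular transformation of $\Theta_L$ if $W_{\Theta_\alpha}(z)=W_{\Theta_L}(z)\cdot(-e^{2i\alpha})$. It is a known result that for every $\alpha$ there is such an $L$-system $\Theta_\alpha$ with the same main operator $T$. **$F$-systems and controllers.** An $F$-system with $E=\mathbb C$, $J=1$, is an array $\Theta_F=\begin{pmatrix}M\ \ F&K_2&1\\ \mathcal H_2&&\mathbb C\end{pmatrix}$ with $\mathcal H_2$ a Hilbert space, $M\in[\mathcal H_2,\mathcal H_2]$, $K_2\in[\mathbb C,\mathcal H_2]$, $\mathrm{Im}\,M=K_2K_2^*$,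 and $F$ an orthogonal projection in $\mathcal H_2$; $\rho(M,F)$ is the set of $z$ for which $M-zF$ is boundedly invertible on $\mathcal H_2$, and its transfer function is $W_{\Theta_F}(z)=1-2iK_2^*(M-zF)^{-1}K_2$, $z\in\rho(M,F)$. For $\alpha\in(0,\frac\pi2)\cup(\frac\pi2,\pi)$ the controller $\Theta_{0,\alpha}$ is $$\Theta_{0,\alpha}=\begin{pmatrix}\tan\alpha+i\ \ 0&1&1\\ \mathbb C&&\mathbb C\end{pmatrix},$$ i.e. $\mathcal H_2=\mathbb C$, $M=\tan\alpha+i$, $F=0$, $K_2=1$. For the remaining values the controller is the coupling $$\Theta_{0,\frac\pi2}=\Theta_{0,\frac\pi4}\cdot\Theta_{0,\frac{3\pi}4},\qquad \Theta_{0,0}=\Theta_{0,\frac{3\pi}4}\cdot\Theta_{0,\frac{3\pi}4},$$ where the coupling $\Theta_{0,\beta}\cdot\Theta_{0,\gamma}$ has $\mathcal H_2=\mathbb C\oplus\mathbb C$, $M=\begin{pmatrix}\tan\beta+i&2i\\ 0&\tan\gamma+i\end{pmatrix}$, $F=0$, $K_2=\begin{pmatrix}1\\ 1\end{pmatrix}$, $J=1$. **$LF$-coupling.** Put $\mathcal H_\pm=\mathcal H_{\pm1}\oplus\mathcal H_2$, $\mathcal H=\mathcal H_1\oplus\mathcal H_2$, and $$\mathbb M=\begin{pmatrix}\mathbb A&2iK_1K_2^*\\ 0&M\end{pmatrix}\in[\mathcal H_+,\mathcal H_-],\quad \mathbb F=\begin{pmatrix}I&0\\ 0&F\end{pmatrix}:\mathcal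 H\to\mathcal H,\quad K=\begin{pmatrix}K_1\\ K_2\end{pmatrix}:\mathbb C\to\mathcal H_-.$$ The $LF$-coupling is $\Theta_{LF}=\Theta_L\cdot\Theta_F=\begin{pmatrix}\mathbb M\ \ \mathbb F&K&1\\ \mathcal H_+\subset\mathcal H\subset\mathcal H_-&&\mathbb C\end{pmatrix}$, with transfer function $W_{\Theta_{LF}}(z)=1-2iK^*(\mathbb M-z\mathbb F)^{-1}K$, where $(\mathbb M-z\mathbb F)^{-1}Ke$ is the unique solution $x\in\mathcal H_+$ of $(\mathbb M-z\mathbb F)x=Ke$; its domain is the set $\rho(\mathbb M,\mathbb F)$ of $z$ for which such unique solutions exist for all $e\in\mathbb C$. **Equivalence.** An $L$-system $\Theta$ and an $LF$-coupling $\Theta_{LF}$ are equivalent if $W_\Theta(z)$ and $W_{\Theta_{LF}}(z)$ coincide on the intersection of their domains of definition. *)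

theory Defs
  imports "HOL-Analysis.Analysis"
begin

section \<open>Complex Hilbert spaces\<close>

text \<open>The inner product is linear in its first and conjugate-linear in its second argument.
  Positive definiteness is a consequence of the last axiom and the norm axioms.\<close>

class complex_hilbert = banach +
  fixes scaleC :: "complex \<Rightarrow> 'a \<Rightarrow> 'a" (infixr "*\<^sub>C" 75)
    and cinner :: "'a \<Rightarrow> 'a \<Rightarrow> complex"
  assumes scaleC_add_right: "a *\<^sub>C (x + y) = a *\<^sub>C x + a *\<^sub>C y"
    and scaleC_add_left: "(a + b) *\<^sub>C x = a *\<^sub>C x + b *\<^sub>C x"
    and scaleC_scaleC: "a *\<^sub>C (b *\<^sub>C x) = (a * b) *\<^sub>C x"
    and scaleC_one: "1 *\<^sub>C x = x"
    and scaleR_scaleC: "scaleR r x = complex_of_real r *\<^sub>C x"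
    and cinner_commute: "cinner x y = cnj (cinner y x)"
    and cinner_add_left: "cinner (x + y) z = cinner x z + cinner y z"
    and cinner_scaleC_left: "cinner (a *\<^sub>C x) y = a * cinner x y"
    and norm_eq_sqrt_cinner: "norm x = sqrt (Re (cinner x x))"

interpretation complex_vector:
  vector_space "scaleC :: complex \<Rightarrow> 'a \<Rightarrow> 'a::complex_hilbert"
  by unfold_locales
    (rule scaleC_add_right scaleC_add_left scaleC_scaleC scaleC_one)+

instantiation complex :: complex_hilbert
begin

definition scaleC_complex :: "complex \<Rightarrow> complex \<Rightarrow> complex"
  where "scaleC_complex a x = a * x"

definition cinner_complex :: "complex \<Rightarrow> complex \<Rightarrow> complex"
  where "cinner_complex x y = x * cnj y"

instance
proof
  fix x :: complex
  show "norm x = sqrt (Re (cinner x x))"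
    by (simp add: cinner_complex_def complex_mult_cnj cmod_def)
qed (simp_all add: scaleC_complex_def cinner_complex_def algebra_simps scaleR_conv_of_real)

end

instantiation prod :: (complex_hilbert, complex_hilbert) complex_hilbert
begin

definition scaleC_prod :: "complex \<Rightarrow> 'a \<times> 'b \<Rightarrow> 'a \<times> 'b"
  where "scaleC_prod a x = (a *\<^sub>C fst x, a *\<^sub>C snd x)"

definition cinner_prod :: "'a \<times> 'b \<Rightarrow> 'a \<times> 'b \<Rightarrow> complex"
  where "cinner_prod x y = cinner (fst x) (fst y) + cinner (snd x) (snd y)"

instance
proof
  fix x y :: "'a \<times> 'b"
  show "cinner x y = cnj (cinner y x)"
    by (simp add: cinner_prod_def cinner_commute[symmetric])
  have nn: "0 \<le> Re (cinner u u)" for u :: "'c::complex_hilbert"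
    using norm_ge_zero[of u] by (simp add: norm_eq_sqrt_cinner)
  have sq: "(norm u)\<^sup>2 = Re (cinner u u)" for u :: "'c::complex_hilbert"
    using nn[of u] by (simp add: norm_eq_sqrt_cinner)
  show "norm x = sqrt (Re (cinner x x))"
    by (simp add: norm_prod_def cinner_prod_def sq)
qed (simp_all add: scaleC_prod_def cinner_prod_def prod_eq_iff algebra_simps
      scaleC_add_right scaleC_add_left scaleC_scaleC scaleC_one scaleR_scaleC
      cinner_add_left cinner_scaleC_left)

end

definition bounded_clinear :: "('a::complex_hilbert \<Rightarrow> 'b::complex_hilbert) \<Rightarrow> bool"
  where "bounded_clinear S \<longleftrightarrow> bounded_linear S \<and> (\<forall>c x. S (c *\<^sub>C x) = c *\<^sub>C S x)"

definition cadjoint :: "('a::complex_hilbert \<Rightarrow> 'b::complex_hilbert) \<Rightarrow> 'b \<Rightarrow> 'a"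
  where "cadjoint S = (THE R. \<forall>x y. cinner (S x) y = cinner x (R y))"


section \<open>Unbounded operators\<close>

text \<open>An operator is represented by its graph; hence \<open>S \<subseteq> T\<close> says that \<open>T\<close> extends \<open>S\<close>,
  and \<open>Domain T\<close> is the domain of \<open>T\<close>.\<close>

type_synonym 'a operator = "('a \<times> 'a) set"

definition linear_operator :: "'a::complex_hilbert operator \<Rightarrow> bool"
  where "linear_operator T \<longleftrightarrow> complex_vector.subspace T \<and> single_valued T"

definition apply_op :: "'a operator \<Rightarrow> 'a \<Rightarrow> 'a"
  where "apply_op T f = (THE g. (f, g) \<in> T)"

definition densely_defined :: "'a::complex_hilbert operator \<Rightarrow> bool"
  where "densely_defined T \<longleftrightarrow> closure (Domain T) = UNIV"

text \<open>The adjoint relative to a closed subspace \<open>L\<close>; it is the graph of an operator in \<open>L\<close>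
  when the domain of \<open>T\<close> is a dense subset of \<open>L\<close>.\<close>

definition adjoint_in :: "'a::complex_hilbert set \<Rightarrow> 'a operator \<Rightarrow> 'a operator"
  where "adjoint_in L T =
    {(g, h). g \<in> L \<and> h \<in> L \<and> (\<forall>(f, f') \<in> T. cinner f' g = cinner f h)}"

abbreviation adj_op :: "'a::complex_hilbert operator \<Rightarrow> 'a operator"
  where "adj_op \<equiv> adjoint_in UNIV"

definition symmetric_operator :: "'a::complex_hilbert operator \<Rightarrow> bool"
  where "symmetric_operator T \<longleftrightarrow> T \<subseteq> adj_op T"

definition self_adjoint_in :: "'a::complex_hilbert set \<Rightarrow> 'a operator \<Rightarrow> bool"
  where "self_adjoint_in L T \<longleftrightarrow>
    linear_operator T \<and> T \<subseteq> L \<times> L \<and> closure (Domain T) = L \<and> adjoint_in L T = T"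

definition resolvent_set :: "'a::complex_hilbert operator \<Rightarrow> complex set"
  where "resolvent_set T =
    {z. (\<forall>h. \<exists>!f. (f, h + z *\<^sub>C f) \<in> T) \<and>
        (\<exists>C. \<forall>(f, g) \<in> T. norm f \<le> C * norm (g - z *\<^sub>C f))}"

definition deficiency_space :: "'a::complex_hilbert operator \<Rightarrow> complex \<Rightarrow> 'a set"
  where "deficiency_space A z = {f. (f, z *\<^sub>C f) \<in> adj_op A}"

definition finite_equal_deficiency :: "'a::complex_hilbert operator \<Rightarrow> bool"
  where "finite_equal_deficiency A \<longleftrightarrow>
    (\<exists>B. finite B \<and> deficiency_space A \<i> \<subseteq> complex_vector.span B) \<and>
    (\<exists>B. finite B \<and> deficiency_space A (- \<i>) \<subseteq> complex_vector.span B) \<and>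
    complex_vector.dim (deficiency_space A \<i>) = complex_vector.dim (deficiency_space A (- \<i>))"

definition base_operator :: "'a::complex_hilbert operator \<Rightarrow> bool"
  where "base_operator A \<longleftrightarrow>
    linear_operator A \<and> closed A \<and> densely_defined A \<and> symmetric_operator A \<and>
    finite_equal_deficiency A"

definition orth_proj :: "'a::complex_hilbert set \<Rightarrow> 'a \<Rightarrow> 'a"
  where "orth_proj L x = (THE y. y \<in> L \<and> (\<forall>w\<in>L. cinner (x - y) w = 0))"

text \<open>In terms of graphs, the second conjunct is the usual \<open>P A \<subseteq> A P\<close> for the orthogonal
  projection \<open>P\<close> onto \<open>L\<close>.\<close>

definition reducing_subspace :: "'a::complex_hilbert operator \<Rightarrow> 'a set \<Rightarrow> bool"
  where "reducing_subspace A L \<longleftrightarrow>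
    complex_vector.subspace L \<and> closed L \<and>
    (\<forall>(f, g) \<in> A. (orth_proj L f, orth_proj L g) \<in> A)"

text \<open>The case \<open>L = UNIV\<close> is not excluded: it would make \<open>A\<close> itself self-adjoint, which
  cannot happen for an operator with a quasi-self-adjoint (non-symmetric) extension.\<close>

definition prime_operator :: "'a::complex_hilbert operator \<Rightarrow> bool"
  where "prime_operator A \<longleftrightarrow>
    \<not> (\<exists>L. reducing_subspace A L \<and> L \<noteq> {0} \<and> self_adjoint_in L (A \<inter> L \<times> L))"

definition quasi_self_adjoint_extension ::
    "'a::complex_hilbert operator \<Rightarrow> 'a operator \<Rightarrow> bool"
  where "quasi_self_adjoint_extension A T \<longleftrightarrow>
    linear_operator T \<and> \<not> symmetric_operator T \<and> A \<subseteq> T \<and> T \<subseteq> adj_op A"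

definition Lambda_class :: "'a::complex_hilbert operator \<Rightarrow> 'a operator set"
  where "Lambda_class A =
    {T. quasi_self_adjoint_extension A T \<and> resolvent_set T \<noteq> {} \<and>
        Domain A = Domain T \<inter> Domain (adj_op T)}"


section \<open>The rigged Hilbert space of a symmetric operator\<close>

definition plus_space :: "'a::complex_hilbert operator \<Rightarrow> 'a set"
  where "plus_space A = Domain (adj_op A)"

definition plus_inner :: "'a::complex_hilbert operator \<Rightarrow> 'a \<Rightarrow> 'a \<Rightarrow> complex"
  where "plus_inner A f g =
    cinner f g + cinner (apply_op (adj_op A) f) (apply_op (adj_op A) g)"

definition plus_norm :: "'a::complex_hilbert operator \<Rightarrow> 'a \<Rightarrow> real"
  where "plus_norm A f = sqrt (Re (plus_inner A f f))"

text \<open>An element \<open>\<phi>\<close> of the negative space is the bounded conjugate-linear functional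
  \<open>f \<mapsto> (\<phi>, f)\<close> on the positive space, extended by 0 outside of it so that equality of
  functions is equality in the negative space. Accordingly \<open>(f, \<phi>) = cnj (\<phi> f)\<close>.\<close>

type_synonym 'a functional = "'a \<Rightarrow> complex"

definition minus_space :: "'a::complex_hilbert operator \<Rightarrow> 'a functional set"
  where "minus_space A = {\<phi>.
    (\<forall>f\<in>plus_space A. \<forall>g\<in>plus_space A. \<phi> (f + g) = \<phi> f + \<phi> g) \<and>
    (\<forall>c. \<forall>f\<in>plus_space A. \<phi> (c *\<^sub>C f) = cnj c * \<phi> f) \<and>
    (\<exists>C. \<forall>f\<in>plus_space A. cmod (\<phi> f) \<le> C * plus_norm A f) \<and>
    (\<forall>f. f \<notin> plus_space A \<longrightarrow> \<phi> f = 0)}"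

definition minus_norm :: "'a::complex_hilbert operator \<Rightarrow> 'a functional \<Rightarrow> real"
  where "minus_norm A \<phi> = (SUP f\<in>{f \<in> plus_space A. plus_norm A f \<le> 1}. cmod (\<phi> f))"

definition embed :: "'a::complex_hilbert operator \<Rightarrow> 'a \<Rightarrow> 'a functional"
  where "embed A h = (\<lambda>f. if f \<in> plus_space A then cinner h f else 0)"

text \<open>Bounded operators from the positive to the negative space; only the values on the
  positive space matter.\<close>

definition bounded_plus_minus ::
    "'a::complex_hilbert operator \<Rightarrow> ('a \<Rightarrow> 'a functional) \<Rightarrow> bool"
  where "bounded_plus_minus A B \<longleftrightarrow>
    (\<forall>f\<in>plus_space A. B f \<in> minus_space A) \<and>
    (\<forall>f\<in>plus_space A. \<forall>g\<in>plus_space A. B (f + g) = (\<lambda>h. B f h + B g h)) \<and>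
    (\<forall>c. \<forall>f\<in>plus_space A. B (c *\<^sub>C f) = (\<lambda>h. c * B f h)) \<and>
    (\<exists>C. \<forall>f\<in>plus_space A. minus_norm A (B f) \<le> C * plus_norm A f)"

definition bounded_complex_minus ::
    "'a::complex_hilbert operator \<Rightarrow> (complex \<Rightarrow> 'a functional) \<Rightarrow> bool"
  where "bounded_complex_minus A K \<longleftrightarrow>
    (\<forall>e. K e \<in> minus_space A) \<and>
    (\<forall>d e. K (d + e) = (\<lambda>h. K d h + K e h)) \<and>
    (\<forall>c e. K (c * e) = (\<lambda>h. c * K e h)) \<and>
    (\<exists>C. \<forall>e. minus_norm A (K e) \<le> C * cmod e)"

text \<open>The adjoint of \<open>B\<close>, again from the positive to the negative space, is given by
  \<open>(B f, g) = (f, B* g) = cnj ((B* g) f)\<close>.\<close>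

definition pm_adj ::
    "'a::complex_hilbert operator \<Rightarrow> ('a \<Rightarrow> 'a functional) \<Rightarrow> 'a \<Rightarrow> 'a functional"
  where "pm_adj A B g = (\<lambda>f. if f \<in> plus_space A then cnj (B f g) else 0)"

definition pm_Re ::
    "'a::complex_hilbert operator \<Rightarrow> ('a \<Rightarrow> 'a functional) \<Rightarrow> 'a \<Rightarrow> 'a functional"
  where "pm_Re A B f = (\<lambda>g. (B f g + pm_adj A B f g) / 2)"

definition pm_Im ::
    "'a::complex_hilbert operator \<Rightarrow> ('a \<Rightarrow> 'a functional) \<Rightarrow> 'a \<Rightarrow> 'a functional"
  where "pm_Im A B f = (\<lambda>g. (B f g - pm_adj A B f g) / (2 * \<i>))"

text \<open>The adjoint of \<open>K\<close>, from the positive space to the complex numbers, is given by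
  \<open>(K e, f) = e * cnj (K* f)\<close>.\<close>

definition K_adj :: "(complex \<Rightarrow> 'a functional) \<Rightarrow> 'a \<Rightarrow> complex"
  where "K_adj K f = cnj (K 1 f)"

lemma K_adj_pairing:
  assumes "bounded_complex_minus A K"
  shows "K e f = cinner e (K_adj K f)"
proof -
  have "K (e * 1) = (\<lambda>h. e * K 1 h)"
    using assms unfolding bounded_complex_minus_def by blast
  then show ?thesis
    by (simp add: K_adj_def cinner_complex_def)
qed

definition extends_op ::
    "'a::complex_hilbert operator \<Rightarrow> ('a \<Rightarrow> 'a functional) \<Rightarrow> 'a operator \<Rightarrow> bool"
  where "extends_op A B T \<longleftrightarrow> (\<forall>(f, g) \<in> T. f \<in> plus_space A \<and> B f = embed A g)"

definition quasi_kernel ::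
    "'a::complex_hilbert operator \<Rightarrow> ('a \<Rightarrow> 'a functional) \<Rightarrow> 'a operator"
  where "quasi_kernel A B = {(f, g). f \<in> plus_space A \<and> B f = embed A g}"

definition star_extension ::
    "'a::complex_hilbert operator \<Rightarrow> 'a operator \<Rightarrow> ('a \<Rightarrow> 'a functional) \<Rightarrow> bool"
  where "star_extension A T B \<longleftrightarrow>
    bounded_plus_minus A B \<and>
    extends_op A B T \<and> A \<subseteq> T \<and>
    extends_op A (pm_adj A B) (adj_op T) \<and> A \<subseteq> adj_op T \<and>
    self_adjoint_in UNIV (quasi_kernel A (pm_Re A B))"


section \<open>L-systems\<close>

text \<open>The input-output space is the complex numbers and \<open>J = 1\<close>. The field \<open>sym\<close> is the
  symmetric operator that generates the rigged Hilbert space.\<close>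

record 'a L_array =
  sym :: "'a operator"
  main :: "'a operator"
  state_op :: "'a \<Rightarrow> 'a functional"
  channel :: "complex \<Rightarrow> 'a functional"

definition L_system :: "'a::complex_hilbert L_array \<Rightarrow> bool"
  where "L_system \<Theta> \<longleftrightarrow>
    base_operator (sym \<Theta>) \<and>
    main \<Theta> \<in> Lambda_class (sym \<Theta>) \<and>
    star_extension (sym \<Theta>) (main \<Theta>) (state_op \<Theta>) \<and>
    bounded_complex_minus (sym \<Theta>) (channel \<Theta>) \<and>
    (\<forall>f\<in>plus_space (sym \<Theta>).
      pm_Im (sym \<Theta>) (state_op \<Theta>) f = channel \<Theta> (K_adj (channel \<Theta>) f)) \<and>
    range (channel \<Theta>) = pm_Im (sym \<Theta>) (state_op \<Theta>) ` plus_space (sym \<Theta>)"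

definition minimal_L_system :: "'a::complex_hilbert L_array \<Rightarrow> bool"
  where "minimal_L_system \<Theta> \<longleftrightarrow> L_system \<Theta> \<and> prime_operator (sym \<Theta>)"

definition L_solution :: "'a::complex_hilbert L_array \<Rightarrow> complex \<Rightarrow> 'a functional \<Rightarrow> 'a"
  where "L_solution \<Theta> z \<phi> =
    (THE x. x \<in> plus_space (sym \<Theta>) \<and>
            (\<lambda>g. state_op \<Theta> x g - z * embed (sym \<Theta>) x g) = \<phi>)"

text \<open>The transfer function at \<open>z\<close> is an operator on the complex numbers, applied here to
  \<open>e\<close>; its domain of definition is \<open>L_domain\<close>.\<close>

definition L_domain :: "'a::complex_hilbert L_array \<Rightarrow> complex set"
  where "L_domain \<Theta> = resolvent_set (main \<Theta>)"

definition L_transfer :: "'a::complex_hilbert L_array \<Rightarrow> complex \<Rightarrow> complex \<Rightarrow> complex"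
  where "L_transfer \<Theta> z e =
    e - 2 * \<i> * K_adj (channel \<Theta>) (L_solution \<Theta> z (channel \<Theta> e))"

definition unimodular_transformation ::
    "real \<Rightarrow> 'a::complex_hilbert L_array \<Rightarrow> 'b::complex_hilbert L_array \<Rightarrow> bool"
  where "unimodular_transformation \<alpha> \<Theta> \<Theta>\<^sub>\<alpha> \<longleftrightarrow>
    L_system \<Theta>\<^sub>\<alpha> \<and>
    (\<forall>z \<in> L_domain \<Theta> \<inter> L_domain \<Theta>\<^sub>\<alpha>. \<forall>e.
      L_transfer \<Theta>\<^sub>\<alpha> z e = L_transfer \<Theta> z e * (- exp (2 * \<i> * complex_of_real \<alpha>)))"


section \<open>F-systems and controllers\<close>

record 'h F_array =
  F_M :: "'h \<Rightarrow> 'h"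
  F_F :: "'h \<Rightarrow> 'h"
  F_K :: "complex \<Rightarrow> 'h"

definition orthogonal_projection :: "('h::complex_hilbert \<Rightarrow> 'h) \<Rightarrow> bool"
  where "orthogonal_projection P \<longleftrightarrow>
    bounded_clinear P \<and> P \<circ> P = P \<and> (\<forall>x y. cinner (P x) y = cinner x (P y))"

definition F_system :: "'h::complex_hilbert F_array \<Rightarrow> bool"
  where "F_system \<Theta> \<longleftrightarrow>
    bounded_clinear (F_M \<Theta>) \<and> bounded_clinear (F_K \<Theta>) \<and>
    orthogonal_projection (F_F \<Theta>) \<and>
    (\<forall>x. (1 / (2 * \<i>)) *\<^sub>C (F_M \<Theta> x - cadjoint (F_M \<Theta>) x) =
         F_K \<Theta> (cadjoint (F_K \<Theta>) x))"

definition controller :: "real \<Rightarrow> complex F_array"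
  where "controller \<alpha> =
    \<lparr> F_M = (\<lambda>x. (complex_of_real (tan \<alpha>) + \<i>) * x), F_F = (\<lambda>x. 0), F_K = (\<lambda>e. e) \<rparr>"

definition coupled_controller :: "real \<Rightarrow> real \<Rightarrow> (complex \<times> complex) F_array"
  where "coupled_controller \<beta> \<gamma> =
    \<lparr> F_M = (\<lambda>(x, y). ((complex_of_real (tan \<beta>) + \<i>) * x + 2 * \<i> * y,
                        (complex_of_real (tan \<gamma>) + \<i>) * y)),
      F_F = (\<lambda>x. 0),
      F_K = (\<lambda>e. (e, e)) \<rparr>"

lemma cadjoint_eqI:
  assumes "\<And>x y. cinner (S x) y = cinner x (R y)"
  shows "cadjoint S = R"
  unfolding cadjoint_def
proof (rule the_equality)
  show "\<forall>x y. cinner (S x) y = cinner x (R y)"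
    using assms by blast
next
  fix Q assume Q: "\<forall>x y. cinner (S x) y = cinner x (Q y)"
  show "Q = R"
  proof
    fix y
    let ?d = "Q y - R y"
    have "cinner ?d (Q y) = cinner ?d (R y)"
      using Q assms by metis
    then have eq: "cinner (Q y) ?d = cinner (R y) ?d"
      by (metis cinner_commute)
    have "cinner (?d + R y) ?d = cinner ?d ?d + cinner (R y) ?d"
      by (rule cinner_add_left)
    then have "cinner ?d ?d = 0"
      using eq by simp
    then have "norm ?d = 0"
      by (simp add: norm_eq_sqrt_cinner)
    then show "Q y = R y"
      by simp
  qed
qed

lemma F_system_controller: "F_system (controller \<alpha>)"
proof -
  have M: "cadjoint (\<lambda>x. (complex_of_real (tan \<alpha>) + \<i>) * x) =
      (\<lambda>x. (complex_of_real (tan \<alpha>) - \<i>) * x)"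
    by (rule cadjoint_eqI) (simp add: cinner_complex_def algebra_simps)
  have K: "cadjoint (\<lambda>e::complex. e) = (\<lambda>e. e)"
    by (rule cadjoint_eqI) simp
  have "(1 / (2 * \<i>)) *\<^sub>C ((complex_of_real (tan \<alpha>) + \<i>) * x -
      (complex_of_real (tan \<alpha>) - \<i>) * x) = x" for x
    by (simp add: scaleC_complex_def left_diff_distrib[symmetric])
  then show ?thesis
    unfolding F_system_def controller_def F_array.simps M K
    by (auto simp: bounded_clinear_def orthogonal_projection_def scaleC_complex_def
        cinner_complex_def bounded_linear_mult_right bounded_linear_ident
        bounded_linear_zero fun_eq_iff)
qed

lemma F_system_coupled_controller: "F_system (coupled_controller \<beta> \<gamma>)"
proof -
  let ?b = "complex_of_real (tan \<beta>)" and ?c = "complex_of_real (tan \<gamma>)"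
  let ?M = "\<lambda>(x, y). ((?b + \<i>) * x + 2 * \<i> * y, (?c + \<i>) * y)"
  have M: "cadjoint ?M = (\<lambda>(x, y). ((?b - \<i>) * x, - 2 * \<i> * x + (?c - \<i>) * y))"
    by (rule cadjoint_eqI)
      (auto simp: cinner_complex_def cinner_prod_def algebra_simps split: prod.splits)
  have K: "cadjoint (\<lambda>e::complex. (e, e)) = (\<lambda>(x, y). x + y)"
    by (rule cadjoint_eqI)
      (auto simp: cinner_complex_def cinner_prod_def algebra_simps split: prod.splits)
  have "bounded_linear (\<lambda>p. ((?b + \<i>) * fst p + 2 * \<i> * snd p, (?c + \<i>) * snd p))"
    by (intro bounded_linear_Pair bounded_linear_add bounded_linear_const_mult
        bounded_linear_fst bounded_linear_snd)
  then have blM: "bounded_linear ?M"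
    by (simp add: case_prod_beta')
  have blK: "bounded_linear (\<lambda>e::complex. (e, e))"
    by (intro bounded_linear_Pair bounded_linear_ident)
  have Im: "(1 / (2 * \<i>)) *\<^sub>C
      (?M p - (\<lambda>(x, y). ((?b - \<i>) * x, - 2 * \<i> * x + (?c - \<i>) * y)) p) =
      (\<lambda>e. (e, e)) ((\<lambda>(x, y). x + y) p)" for p
    by (cases p) (simp add: scaleC_prod_def scaleC_complex_def field_simps)
  have "\<forall>c p. ?M (c *\<^sub>C p) = c *\<^sub>C ?M p"
    by (simp add: scaleC_prod_def scaleC_complex_def case_prod_beta' algebra_simps)
  moreover have "orthogonal_projection (\<lambda>p::complex \<times> complex. 0)"
    by (simp add: orthogonal_projection_def bounded_clinear_def bounded_linear_zero
        scaleC_prod_def scaleC_complex_def cinner_prod_def cinner_complex_def fun_eq_iff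
        zero_prod_def[symmetric])
  ultimately show ?thesis
    unfolding F_system_def coupled_controller_def F_array.simps M K
    using blM blK Im
    by (simp add: bounded_clinear_def scaleC_prod_def scaleC_complex_def)
qed


section \<open>LF-couplings\<close>

text \<open>The coupled positive space is the subset \<open>plus_space A \<times> UNIV\<close> of \<open>'a \<times> 'h\<close>, the
  coupled negative space consists of elements of \<open>'a functional \<times> 'h\<close>.\<close>

record ('a, 'h) LF_array =
  LF_sym :: "'a operator"
  LF_M :: "'a \<times> 'h \<Rightarrow> 'a functional \<times> 'h"
  LF_F :: "'a \<times> 'h \<Rightarrow> 'a \<times> 'h"
  LF_K :: "complex \<Rightarrow> 'a functional \<times> 'h"

definition LF_coupling ::
    "'a::complex_hilbert L_array \<Rightarrow> 'h::complex_hilbert F_array \<Rightarrow> ('a, 'h) LF_array"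
  where "LF_coupling \<Theta> \<Phi> =
    \<lparr> LF_sym = sym \<Theta>,
      LF_M = (\<lambda>(x, y).
        ((\<lambda>g. state_op \<Theta> x g + 2 * \<i> * channel \<Theta> (cadjoint (F_K \<Phi>) y) g), F_M \<Phi> y)),
      LF_F = (\<lambda>(x, y). (x, F_F \<Phi> y)),
      LF_K = (\<lambda>e. (channel \<Theta> e, F_K \<Phi> e)) \<rparr>"

definition LF_plus :: "('a::complex_hilbert, 'h) LF_array \<Rightarrow> ('a \<times> 'h) set"
  where "LF_plus \<Omega> = plus_space (LF_sym \<Omega>) \<times> UNIV"

text \<open>\<open>M - z F\<close> as a map into the coupled negative space, into which \<open>'a \<times> 'h\<close> is embedded
  componentwise.\<close>

definition LF_pencil ::
    "('a::complex_hilbert, 'h::complex_hilbert) LF_array \<Rightarrow> complex \<Rightarrow>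
      'a \<times> 'h \<Rightarrow> 'a functional \<times> 'h"
  where "LF_pencil \<Omega> z p =
    ((\<lambda>g. fst (LF_M \<Omega> p) g - z * embed (LF_sym \<Omega>) (fst (LF_F \<Omega> p)) g),
     snd (LF_M \<Omega> p) - z *\<^sub>C snd (LF_F \<Omega> p))"

definition LF_is_solution ::
    "('a::complex_hilbert, 'h::complex_hilbert) LF_array \<Rightarrow> complex \<Rightarrow> complex \<Rightarrow>
      'a \<times> 'h \<Rightarrow> bool"
  where "LF_is_solution \<Omega> z e p \<longleftrightarrow> p \<in> LF_plus \<Omega> \<and> LF_pencil \<Omega> z p = LF_K \<Omega> e"

definition LF_domain ::
    "('a::complex_hilbert, 'h::complex_hilbert) LF_array \<Rightarrow> complex set"
  where "LF_domain \<Omega> = {z. \<forall>e. \<exists>!p. LF_is_solution \<Omega> z e p}"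

text \<open>The adjoint of \<open>K\<close>, from the coupled positive space to the complex numbers, is given by
  \<open>(K e, p) = e * cnj (K* p)\<close> with the componentwise pairing.\<close>

definition LF_K_adj ::
    "('a::complex_hilbert, 'h::complex_hilbert) LF_array \<Rightarrow> 'a \<times> 'h \<Rightarrow> complex"
  where "LF_K_adj \<Omega> p =
    cnj (fst (LF_K \<Omega> 1) (fst p) + cinner (snd (LF_K \<Omega> 1)) (snd p))"

definition LF_transfer ::
    "('a::complex_hilbert, 'h::complex_hilbert) LF_array \<Rightarrow> complex \<Rightarrow> complex \<Rightarrow> complex"
  where "LF_transfer \<Omega> z e =
    e - 2 * \<i> * LF_K_adj \<Omega> (THE p. LF_is_solution \<Omega> z e p)"

definition equivalent_L_LF ::
    "'b::complex_hilbert L_array \<Rightarrow> ('a::complex_hilbert, 'h::complex_hilbert) LF_array \<Rightarrow> bool"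
  where "equivalent_L_LF \<Theta> \<Omega> \<longleftrightarrow>
    (\<forall>z \<in> L_domain \<Theta> \<inter> LF_domain \<Omega>. \<forall>e. L_transfer \<Theta> z e = LF_transfer \<Omega> z e)"

end

theory Submission
  imports Defs
begin

text \<open>
  Write \<open>A\<close> for the symmetric operator of the L-system, \<open>T\<close> for its main operator and \<open>\<chi>\<close> for the
  element \<open>K 1\<close> of the negative space, so that \<open>K\<^sup>*\<close> is the functional \<open>\<Gamma>\<^sub>0 f = (f, \<chi>)\<close>. Everything
  rests on a normal form of the L-system: there is a second functional \<open>\<Gamma>\<^sub>1\<close> on \<open>Dom A\<^sup>*\<close> such that
  \<open>(\<Gamma>\<^sub>0, \<Gamma>\<^sub>1)\<close> is a boundary triple of \<open>A\<close>, i.e. maps \<open>Dom A\<^sup>*\<close> onto \<open>\<complex>\<^sup>2\<close> and satisfies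
  \<open>(A\<^sup>* f, g) - (f, A\<^sup>* g) = \<Gamma>\<^sub>0 f cnj (\<Gamma>\<^sub>1 g) - \<Gamma>\<^sub>1 f cnj (\<Gamma>\<^sub>0 g)\<close>, and such that the state operator is
  \<open>f \<mapsto> A\<^sup>* f + (\<Gamma>\<^sub>1 f + \<i> \<Gamma>\<^sub>0 f) \<chi>\<close>. The main operator is then the restriction of \<open>A\<^sup>*\<close> to the kernel
  of \<open>\<Gamma>\<^sub>1 + \<i> \<Gamma>\<^sub>0\<close>, the quasi-kernel of the real part is the restriction to the kernel of \<open>\<Gamma>\<^sub>1\<close>, and
  solving the equation that defines the transfer function amounts to picking a vector \<open>x\<close> of
  \<open>ker (A\<^sup>* - z)\<close>; this gives \<open>W z = (\<Gamma>\<^sub>1 x - \<i> \<Gamma>\<^sub>0 x) / (\<Gamma>\<^sub>1 x + \<i> \<Gamma>\<^sub>0 x)\<close>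
  (\<open>realized_by_boundary_triple\<close>, \<open>realized_transfer\<close>).

  Conversely each boundary triple defines an L-system (\<open>L_system_triple_system\<close>). Rotating the pair
  \<open>(\<Gamma>\<^sub>0, \<Gamma>\<^sub>1)\<close> by a real angle multiplies \<open>\<Gamma>\<^sub>1 + \<i> \<Gamma>\<^sub>0\<close> and \<open>\<Gamma>\<^sub>1 - \<i> \<Gamma>\<^sub>0\<close> by conjugate unimodular
  constants. The result is again a boundary triple, its main operator is still \<open>T\<close>, and \<open>W\<close> is
  multiplied by a unimodular constant; the angle can be chosen such that this constant is
  \<open>- exp (2 \<i> \<alpha>)\<close>. This is the unimodular transformation (\<open>unimodular_transformation_exists\<close>).

  On the other side, elimination of the second component from the equation of an LF-coupling gives
  the multiplication theorem \<open>W\<^sub>L\<^sub>F = W\<^sub>L W\<^sub>F\<close> (\<open>LF_transfer_factorizes\<close>). A controller has \<open>F = 0\<close>, so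
  its transfer function is constant; for the simple controllers it is
  \<open>(tan \<alpha> - \<i>) / (tan \<alpha> + \<i>) = - exp (2 \<i> \<alpha>)\<close>, and for the coupled ones it is the product of two
  such factors.
\<close>


section \<open>Complex Hilbert spaces\<close>

lemma cinner_add_right: "cinner x (y + z) = cinner x y + cinner x z"
  by (metis cinner_commute cinner_add_left complex_cnj_add)

lemma cinner_scaleC_right: "cinner x (c *\<^sub>C y) = cnj c * cinner x y"
  by (metis cinner_commute cinner_scaleC_left complex_cnj_mult)

lemma scaleC_minus_one: "(- 1) *\<^sub>C x = - x"
  by (metis complex_vector.scale_minus_left scaleC_one)

lemma cinner_minus_left: "cinner (- x) y = - cinner x y"
  using cinner_scaleC_left[of "- 1" x y] by (simp add: scaleC_minus_one)

lemma cinner_minus_right: "cinner x (- y) = - cinner x y"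
  using cinner_scaleC_right[of x "- 1" y] by (simp add: scaleC_minus_one)

lemma cinner_diff_left: "cinner (x - y) z = cinner x z - cinner y z"
  using cinner_add_left[of x "- y" z] by (simp add: cinner_minus_left)

lemma cinner_diff_right: "cinner x (y - z) = cinner x y - cinner x z"
  using cinner_add_right[of x y "- z"] by (simp add: cinner_minus_right)

lemma cinner_zero_left [simp]: "cinner 0 y = 0"
  using cinner_diff_left[of 0 0 y] by simp

lemma cinner_zero_right [simp]: "cinner x 0 = 0"
  using cinner_diff_right[of x 0 0] by simp

lemmas cinner_algebra = cinner_add_left cinner_add_right cinner_diff_left cinner_diff_right
  cinner_scaleC_left cinner_scaleC_right cinner_minus_left cinner_minus_right

lemma cinner_self: "cinner x x = complex_of_real ((norm x)\<^sup>2)"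
proof -
  have "Im (cinner x x) = 0"
    by (metis cinner_commute complex_cnj_cancel_iff Reals_cnj_iff complex_is_Real_iff)
  moreover have "Re (cinner x x) = (norm x)\<^sup>2"
    by (metis norm_eq_sqrt_cinner norm_ge_zero real_sqrt_ge_0_iff real_sqrt_pow2)
  ultimately show ?thesis
    by (simp add: complex_eq_iff)
qed

lemma cinner_self_eq_0_iff [simp]: "cinner x x = 0 \<longleftrightarrow> x = 0"
  by (simp add: cinner_self)

lemma norm_add_squared: "(norm (x + y))\<^sup>2 = (norm x)\<^sup>2 + (norm y)\<^sup>2 + 2 * Re (cinner x y)"
proof -
  have "cinner (x + y) (x + y) = cinner x x + cinner y y + (cinner x y + cnj (cinner x y))"
    using cinner_commute[of y x] by (simp add: cinner_algebra)
  then have "complex_of_real ((norm (x + y))\<^sup>2) =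
      complex_of_real ((norm x)\<^sup>2 + (norm y)\<^sup>2 + 2 * Re (cinner x y))"
    by (simp add: cinner_self complex_add_cnj)
  then show ?thesis
    using of_real_eq_iff by blast
qed

lemma norm_diff_squared: "(norm (x - y))\<^sup>2 = (norm x)\<^sup>2 + (norm y)\<^sup>2 - 2 * Re (cinner x y)"
  using norm_add_squared[of x "- y"] by (simp add: cinner_minus_right)

lemma norm_scaleC: "norm (c *\<^sub>C x) = cmod c * norm x"
proof -
  have "complex_of_real ((norm (c *\<^sub>C x))\<^sup>2) = c * cnj c * complex_of_real ((norm x)\<^sup>2)"
    unfolding cinner_self[symmetric] by (simp add: cinner_algebra)
  also have "\<dots> = complex_of_real ((cmod c * norm x)\<^sup>2)"
    by (simp add: complex_norm_square[symmetric] power_mult_distrib)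
  finally have "(norm (c *\<^sub>C x))\<^sup>2 = (cmod c * norm x)\<^sup>2"
    using of_real_eq_iff by blast
  then show ?thesis
    by (simp add: power2_eq_iff_nonneg)
qed

text \<open>The choice \<open>c = (v, w) / (w, w)\<close> makes \<open>v - c w\<close> orthogonal to \<open>w\<close>, hence shorter than \<open>v\<close>
  unless \<open>c = 0\<close>.\<close>

lemma orthogonal_if_norm_minimal:
  assumes "\<And>c. norm v \<le> norm (v - c *\<^sub>C w)"
  shows "cinner v w = 0"
proof (cases "w = 0")
  case False
  define c where "c = cinner v w / complex_of_real ((norm w)\<^sup>2)"
  have nw: "(norm w)\<^sup>2 > 0"
    using False by simp
  have "(norm v)\<^sup>2 \<le> (norm (v - c *\<^sub>C w))\<^sup>2"
    using assms[of c] by (simp add: power_mono)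
  then have "2 * Re (cnj c * cinner v w) \<le> (cmod c)\<^sup>2 * (norm w)\<^sup>2"
    by (simp add: norm_diff_squared norm_scaleC power_mult_distrib cinner_scaleC_right)
  moreover have "cnj c * cinner v w = complex_of_real ((cmod c)\<^sup>2 * (norm w)\<^sup>2)"
  proof -
    have "cinner v w = c * complex_of_real ((norm w)\<^sup>2)"
      using nw by (simp add: c_def)
    then show ?thesis
      using complex_norm_square[of c] by (simp add: mult.commute mult.left_commute)
  qed
  then have "Re (cnj c * cinner v w) = (cmod c)\<^sup>2 * (norm w)\<^sup>2"
    by (metis Re_complex_of_real)
  ultimately have "(cmod c)\<^sup>2 * (norm w)\<^sup>2 \<le> 0"
    by linarith
  then have "c = 0"
    using nw by (simp add: mult_le_0_iff)
  then show ?thesis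
    using nw by (simp add: c_def)
qed simp

lemma cauchy_schwarz: "cmod (cinner x y) \<le> norm x * norm y"
proof (cases "y = 0")
  case False
  define c where "c = cinner x y / complex_of_real ((norm y)\<^sup>2)"
  have ny: "(norm y)\<^sup>2 > 0"
    using False by simp
  have xy: "cinner x y = c * complex_of_real ((norm y)\<^sup>2)"
    using ny by (simp add: c_def)
  have "cnj c * cinner x y = complex_of_real ((cmod c)\<^sup>2 * (norm y)\<^sup>2)"
    using complex_norm_square[of c] by (simp add: xy mult.commute mult.left_commute)
  then have "(norm (x - c *\<^sub>C y))\<^sup>2 = (norm x)\<^sup>2 - (cmod c)\<^sup>2 * (norm y)\<^sup>2"
    by (simp add: norm_diff_squared norm_scaleC power_mult_distrib cinner_scaleC_right)
  then have "(cmod c * norm y)\<^sup>2 \<le> (norm x)\<^sup>2"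
    by (simp add: power_mult_distrib) (metis diff_ge_0_iff_ge zero_le_power2)
  then have "cmod c * norm y \<le> norm x"
    using power2_le_imp_le norm_ge_zero by blast
  then have "cmod c * norm y * norm y \<le> norm x * norm y"
    by (simp add: mult_right_mono)
  then show ?thesis
    by (simp add: xy norm_mult power2_eq_square mult.assoc)
qed simp

lemma bounded_linear_cinner_left: "bounded_linear (\<lambda>x. cinner x y)"
proof (rule bounded_linear_intro[where K = "norm y"])
  show "cinner (r *\<^sub>R x) y = r *\<^sub>R cinner x y" for r x
    by (simp only: scaleR_scaleC[of r x] cinner_scaleC_left scaleR_conv_of_real)
qed (simp_all add: cinner_add_left cauchy_schwarz)

text \<open>By the parallelogram law a sequence in \<open>S\<close> whose norms tend to their infimum is a Cauchy sequence.\<close>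

lemma closed_convex_min_norm:
  fixes S :: "'a::complex_hilbert set"
  assumes "closed S" "convex S" "S \<noteq> {}"
  obtains v where "v \<in> S" "\<And>x. x \<in> S \<Longrightarrow> norm v \<le> norm x"
proof -
  define d where "d = (INF x\<in>S. norm x)"
  have bdd: "bdd_below (norm ` S)"
    by (rule bdd_belowI2[where m = 0]) simp
  have d_le: "d \<le> norm x" if "x \<in> S" for x
    unfolding d_def by (rule cINF_lower[OF bdd that])
  have d0: "0 \<le> d"
    unfolding d_def by (rule cINF_greatest) (use assms in auto)
  have "\<exists>x\<in>S. norm x < d + 1 / real (Suc n)" for n
    using cInf_lessD[of "norm ` S" "d + 1 / real (Suc n)"] assms(3)
    by (auto simp: d_def)
  then obtain x where xS: "\<And>n. x n \<in> S" and xd: "\<And>n. norm (x n) < d + 1 / real (Suc n)"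
    by metis
  have "(\<lambda>n. d + 1 / real (Suc n)) \<longlonglongrightarrow> d + 0"
    by (intro tendsto_add tendsto_const LIMSEQ_Suc[OF lim_1_over_n])
  then have lim_norm: "(\<lambda>n. norm (x n)) \<longlonglongrightarrow> d"
    using d_le[OF xS] less_imp_le[OF xd]
    by (intro tendsto_sandwich[of "\<lambda>_. d" "\<lambda>n. norm (x n)"] always_eventually allI) simp_all
  \<comment> \<open>The parallelogram law; the midpoint of two members of \<open>S\<close> has norm at least \<open>d\<close>.\<close>
  have par: "(norm (x m - x n))\<^sup>2 \<le> 2 * ((norm (x m))\<^sup>2 - d\<^sup>2) + 2 * ((norm (x n))\<^sup>2 - d\<^sup>2)" for m n
  proof -
    have "(1 / 2) *\<^sub>R x m + (1 / 2) *\<^sub>R x n \<in> S"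
      by (rule convexD[OF assms(2) xS xS]) simp_all
    then have "d \<le> norm ((1 / 2) *\<^sub>R (x m + x n))"
      using d_le by (simp add: scaleR_add_right)
    then have "2 * d \<le> norm (x m + x n)"
      by simp
    then have "(2 * d)\<^sup>2 \<le> (norm (x m + x n))\<^sup>2"
      using d0 by (intro power_mono) auto
    then show ?thesis
      by (simp add: norm_diff_squared norm_add_squared power_mult_distrib)
  qed
  have "Cauchy x"
  proof (rule CauchyI)
    fix e :: real assume e: "0 < e"
    have "(\<lambda>n. (norm (x n))\<^sup>2 - d\<^sup>2) \<longlonglongrightarrow> d\<^sup>2 - d\<^sup>2"
      by (rule tendsto_diff[OF tendsto_power[OF lim_norm] tendsto_const])
    then have "eventually (\<lambda>n. (norm (x n))\<^sup>2 - d\<^sup>2 < e\<^sup>2 / 4) sequentially"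
      by (rule order_tendstoD(2)) (use e in simp)
    then obtain N where N: "\<And>n. n \<ge> N \<Longrightarrow> (norm (x n))\<^sup>2 - d\<^sup>2 < e\<^sup>2 / 4"
      by (auto simp: eventually_sequentially)
    have "norm (x m - x n) < e" if "m \<ge> N" "n \<ge> N" for m n
    proof (rule power2_less_imp_less)
      show "(norm (x m - x n))\<^sup>2 < e\<^sup>2"
        using par[of m n] N[OF that(1)] N[OF that(2)] by simp
    qed (use e in simp)
    then show "\<exists>M. \<forall>m\<ge>M. \<forall>n\<ge>M. norm (x m - x n) < e"
      by blast
  qed
  then obtain v where v: "x \<longlonglongrightarrow> v"
    using Cauchy_convergent_iff convergent_def by blast
  have "v \<in> S"
    using closed_sequentially[OF assms(1)] xS v by blast
  moreover have "norm v = d"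
    using LIMSEQ_unique[OF tendsto_norm[OF v] lim_norm] .
  ultimately show thesis
    using that d_le by metis
qed

text \<open>The vector of smallest norm on the hyperplane \<open>\<phi> = 1\<close> is orthogonal to the kernel of \<open>\<phi>\<close>, so
  a multiple of it represents \<open>\<phi>\<close>.\<close>

lemma riesz_representation:
  fixes \<phi> :: "'a::complex_hilbert \<Rightarrow> complex"
  assumes "bounded_clinear \<phi>"
  obtains g where "\<And>x. \<phi> x = cinner x g"
proof (cases "\<forall>x. \<phi> x = 0")
  case True
  then show thesis
    using that[of 0] by simp
next
  case False
  interpret bounded_linear \<phi>
    using assms by (simp add: bounded_clinear_def)
  have scale': "\<phi> (c *\<^sub>C x) = c * \<phi> x" for c x
    using assms by (simp add: bounded_clinear_def scaleC_complex_def)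
  obtain u where u: "\<phi> u \<noteq> 0"
    using False by blast
  let ?S = "{x. \<phi> x = 1}"
  have "closed ?S"
    by (intro closed_Collect_eq continuous_on continuous_on_id continuous_on_const)
  moreover have "convex ?S"
    by (auto simp: convex_def add scaleR scaleR_conv_of_real of_real_add[symmetric])
  moreover have "(1 / \<phi> u) *\<^sub>C u \<in> ?S"
    using u by (simp add: scale')
  ultimately obtain v where "v \<in> ?S" and "\<And>x. x \<in> ?S \<Longrightarrow> norm v \<le> norm x"
    using closed_convex_min_norm[of ?S] by (metis empty_iff)
  then have v: "\<phi> v = 1" and vmin: "\<And>x. \<phi> x = 1 \<Longrightarrow> norm v \<le> norm x"
    by simp_all
  have "v \<noteq> 0"
    using v zero by fastforce
  have orth: "cinner w v = 0" if "\<phi> w = 0" for w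
  proof -
    have "cinner v w = 0"
    proof (rule orthogonal_if_norm_minimal)
      show "norm v \<le> norm (v - c *\<^sub>C w)" for c
        by (rule vmin) (simp add: diff scale' v that)
    qed
    then show ?thesis
      using cinner_commute[of w v] by simp
  qed
  define n where "n = (norm v)\<^sup>2"
  have n: "n \<noteq> 0"
    using \<open>v \<noteq> 0\<close> by (simp add: n_def)
  have "\<phi> x = cinner x ((1 / complex_of_real n) *\<^sub>C v)" for x
  proof -
    have "cinner (x - \<phi> x *\<^sub>C v) v = 0"
      by (rule orth) (simp add: diff scale' v)
    then have "cinner x v = \<phi> x * complex_of_real n"
      by (simp add: cinner_algebra cinner_self n_def)
    then show ?thesis
      using n by (simp add: cinner_scaleC_right)
  qed
  then show thesis
    using that by blast
qed


section \<open>Adjoints\<close>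

abbreviation adj_map :: "'a::complex_hilbert operator \<Rightarrow> 'a \<Rightarrow> 'a"
  where "adj_map A \<equiv> apply_op (adj_op A)"

lemma adj_op_iff: "(g, h) \<in> adj_op T \<longleftrightarrow> (\<forall>f f'. (f, f') \<in> T \<longrightarrow> cinner f' g = cinner f h)"
  by (auto simp: adjoint_in_def)

lemma adj_op_antimono: "S \<subseteq> T \<Longrightarrow> adj_op T \<subseteq> adj_op S"
  unfolding adjoint_in_def by blast

lemma adj_op_add:
  "(f, g) \<in> adj_op T \<Longrightarrow> (f', g') \<in> adj_op T \<Longrightarrow> (f + f', g + g') \<in> adj_op T"
  by (simp add: adj_op_iff cinner_algebra)

lemma adj_op_scaleC: "(f, g) \<in> adj_op T \<Longrightarrow> (c *\<^sub>C f, c *\<^sub>C g) \<in> adj_op T"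
  by (simp add: adj_op_iff cinner_algebra)

lemma adj_op_zero: "(0, 0) \<in> adj_op T"
  by (simp add: adj_op_iff)

lemma densely_defined_orthogonal_zero:
  assumes "densely_defined A" "\<And>f. f \<in> Domain A \<Longrightarrow> cinner f x = 0"
  shows "x = 0"
proof -
  have "continuous_on UNIV (\<lambda>f. cinner f x)"
    by (rule bounded_linear.continuous_on[OF bounded_linear_cinner_left continuous_on_id])
  then have "closed {f. cinner f x = 0}"
    by (rule closed_Collect_eq[OF _ continuous_on_const])
  then have "closure (Domain A) \<subseteq> {f. cinner f x = 0}"
    using assms(2) by (intro closure_minimal) auto
  then have "x \<in> {f. cinner f x = 0}"
    using assms(1) by (simp only: densely_defined_def) blast
  then have "cinner x x = 0"
    by simp
  then show ?thesis
    by simp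
qed

lemma adj_op_unique:
  assumes "densely_defined A" "(f, g) \<in> adj_op A" "(f, h) \<in> adj_op A"
  shows "g = h"
proof -
  have "g - h = 0"
    by (rule densely_defined_orthogonal_zero[OF assms(1)])
      (use assms(2,3) in \<open>auto simp: adj_op_iff cinner_diff_right\<close>)
  then show ?thesis
    by simp
qed

lemma adj_map_eq:
  assumes "densely_defined A" "(f, g) \<in> adj_op A"
  shows "adj_map A f = g"
  unfolding apply_op_def using assms adj_op_unique by blast

lemma adj_op_iff_adj_map:
  assumes "densely_defined A"
  shows "(f, g) \<in> adj_op A \<longleftrightarrow> f \<in> plus_space A \<and> g = adj_map A f"
  using adj_map_eq[OF assms] by (auto simp: plus_space_def)

lemma plus_space_add: "f \<in> plus_space A \<Longrightarrow> g \<in> plus_space A \<Longrightarrow> f + g \<in> plus_space A"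
  by (auto simp: plus_space_def intro: adj_op_add)

lemma plus_space_scaleC: "f \<in> plus_space A \<Longrightarrow> c *\<^sub>C f \<in> plus_space A"
  by (auto simp: plus_space_def intro: adj_op_scaleC)

lemma plus_space_zero: "0 \<in> plus_space A"
  by (auto simp: plus_space_def intro: adj_op_zero)

lemma plus_space_diff: "f \<in> plus_space A \<Longrightarrow> g \<in> plus_space A \<Longrightarrow> f - g \<in> plus_space A"
  using plus_space_add[of f A "(- 1) *\<^sub>C g"] plus_space_scaleC[of g A "- 1"]
  by (simp add: scaleC_minus_one)

lemma adj_map_add:
  assumes "densely_defined A" "f \<in> plus_space A" "g \<in> plus_space A"
  shows "adj_map A (f + g) = adj_map A f + adj_map A g"
  using assms adj_map_eq adj_op_add by (metis adj_op_iff_adj_map)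

lemma adj_map_scaleC:
  assumes "densely_defined A" "f \<in> plus_space A"
  shows "adj_map A (c *\<^sub>C f) = c *\<^sub>C adj_map A f"
  using assms adj_map_eq adj_op_scaleC by (metis adj_op_iff_adj_map)

lemma adj_map_diff:
  assumes "densely_defined A" "f \<in> plus_space A" "g \<in> plus_space A"
  shows "adj_map A (f - g) = adj_map A f - adj_map A g"
  using adj_map_add[OF assms(1,2), of "(- 1) *\<^sub>C g"] adj_map_scaleC[OF assms(1,3), of "- 1"]
    plus_space_scaleC[OF assms(3), of "- 1"]
  by (simp add: scaleC_minus_one)

lemma plus_norm_eq:
  "plus_norm A f = sqrt ((norm f)\<^sup>2 + (norm (adj_map A f))\<^sup>2)"
  by (simp add: plus_norm_def plus_inner_def cinner_self)

lemma norm_le_plus_norm: "norm f \<le> plus_norm A f"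
  unfolding plus_norm_eq by (rule real_le_rsqrt) simp

lemma norm_adj_map_le_plus_norm: "norm (adj_map A f) \<le> plus_norm A f"
  unfolding plus_norm_eq by (rule real_le_rsqrt) simp

lemma plus_norm_nonneg: "0 \<le> plus_norm A f"
  unfolding plus_norm_eq by simp

lemma minus_norm_le:
  assumes "densely_defined A" "0 \<le> C"
    and bound: "\<And>f. f \<in> plus_space A \<Longrightarrow> cmod (\<phi> f) \<le> C * plus_norm A f"
  shows "minus_norm A \<phi> \<le> C"
  unfolding minus_norm_def
proof (rule cSUP_least)
  have "plus_norm A 0 = 0"
    using adj_map_eq[OF assms(1) adj_op_zero] by (simp add: plus_norm_eq)
  then have "0 \<in> {f \<in> plus_space A. plus_norm A f \<le> 1}"
    by (simp add: plus_space_zero)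
  then show "{f \<in> plus_space A. plus_norm A f \<le> 1} \<noteq> {}"
    by blast
next
  fix f assume "f \<in> {f \<in> plus_space A. plus_norm A f \<le> 1}"
  then show "cmod (\<phi> f) \<le> C"
    using bound[of f] mult_left_mono[OF _ assms(2), of "plus_norm A f" 1] by simp
qed

text \<open>If \<open>R\<close> denotes the resolvent of \<open>T\<close> at \<open>z\<close>, then \<open>g = R\<^sup>* h\<close>, which the Riesz representation
  of \<open>u \<mapsto> (R u, h)\<close> provides.\<close>

lemma resolvent_adjoint_surj:
  assumes "linear_operator T" "z \<in> resolvent_set T"
  shows "\<exists>g. (g, h + cnj z *\<^sub>C g) \<in> adj_op T"
proof -
  have ex1: "\<exists>!f. (f, u + z *\<^sub>C f) \<in> T" for u
    using assms(2) by (auto simp: resolvent_set_def)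
  define R where "R u = (THE f. (f, u + z *\<^sub>C f) \<in> T)" for u
  have RT: "(R u, u + z *\<^sub>C R u) \<in> T" for u
    unfolding R_def by (rule theI'[OF ex1])
  have R_eq: "R u = f" if "(f, u + z *\<^sub>C f) \<in> T" for u f
    using ex1 RT that by blast
  have sub: "complex_vector.subspace T"
    using assms(1) by (simp add: linear_operator_def)
  have R_add: "R (u + v) = R u + R v" for u v
    using complex_vector.subspace_add[OF sub RT[of u] RT[of v]]
    by (intro R_eq) (simp add: scaleC_add_right algebra_simps)
  have R_scale: "R (c *\<^sub>C u) = c *\<^sub>C R u" for c u
    using complex_vector.subspace_scale[OF sub RT[of u], of c]
    by (intro R_eq) (simp add: scaleC_prod_def scaleC_add_right scaleC_scaleC mult.commute)
  obtain C where C: "\<And>f g. (f, g) \<in> T \<Longrightarrow> norm f \<le> C * norm (g - z *\<^sub>C f)"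
    using assms(2) unfolding resolvent_set_def by fast
  have R_bound: "norm (R u) \<le> norm u * C" for u
    using C[OF RT[of u]] by (simp add: mult.commute)
  have "bounded_linear (\<lambda>u. cinner (R u) h)"
  proof (rule bounded_linear_intro[where K = "C * norm h"])
    show "cmod (cinner (R u) h) \<le> norm u * (C * norm h)" for u
      using order_trans[OF cauchy_schwarz mult_right_mono[OF R_bound norm_ge_zero], of u h]
      by (simp add: mult.assoc)
    show "cinner (R (r *\<^sub>R u)) h = r *\<^sub>R cinner (R u) h" for r u
      by (simp only: scaleR_scaleC[of r u] R_scale cinner_scaleC_left scaleR_conv_of_real)
  qed (simp add: R_add cinner_algebra)
  then have "bounded_clinear (\<lambda>u. cinner (R u) h)"
    by (simp add: bounded_clinear_def R_scale cinner_algebra scaleC_complex_def)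
  then obtain g where g: "\<And>u. cinner (R u) h = cinner u g"
    by (rule riesz_representation) blast
  have "cinner f' g = cinner f (h + cnj z *\<^sub>C g)" if "(f, f') \<in> T" for f f'
  proof -
    have "R (f' - z *\<^sub>C f) = f"
      using that by (intro R_eq) simp
    then show ?thesis
      using g[of "f' - z *\<^sub>C f"] by (simp add: cinner_algebra)
  qed
  then show ?thesis
    by (auto simp: adj_op_iff)
qed

section \<open>Boundary triples and their L-systems\<close>

text \<open>Boundary triples in the sense of extension theory, with one-dimensional boundary space. Continuity
  refers to the graph norm, so that \<open>\<Gamma>\<^sub>0\<close> and \<open>\<Gamma>\<^sub>1\<close> represent elements of the negative space.\<close>

locale boundary_triple =
  fixes A :: "'a::complex_hilbert operator" and \<Gamma>\<^sub>0 \<Gamma>\<^sub>1 :: "'a \<Rightarrow> complex"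
  assumes base: "base_operator A"
    and \<Gamma>\<^sub>0_add: "\<lbrakk>f \<in> plus_space A; g \<in> plus_space A\<rbrakk> \<Longrightarrow> \<Gamma>\<^sub>0 (f + g) = \<Gamma>\<^sub>0 f + \<Gamma>\<^sub>0 g"
    and \<Gamma>\<^sub>1_add: "\<lbrakk>f \<in> plus_space A; g \<in> plus_space A\<rbrakk> \<Longrightarrow> \<Gamma>\<^sub>1 (f + g) = \<Gamma>\<^sub>1 f + \<Gamma>\<^sub>1 g"
    and \<Gamma>\<^sub>0_scaleC: "f \<in> plus_space A \<Longrightarrow> \<Gamma>\<^sub>0 (c *\<^sub>C f) = c * \<Gamma>\<^sub>0 f"
    and \<Gamma>\<^sub>1_scaleC: "f \<in> plus_space A \<Longrightarrow> \<Gamma>\<^sub>1 (c *\<^sub>C f) = c * \<Gamma>\<^sub>1 f"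
    and \<Gamma>\<^sub>0_bounded: "\<exists>C. \<forall>f\<in>plus_space A. cmod (\<Gamma>\<^sub>0 f) \<le> C * plus_norm A f"
    and \<Gamma>\<^sub>1_bounded: "\<exists>C. \<forall>f\<in>plus_space A. cmod (\<Gamma>\<^sub>1 f) \<le> C * plus_norm A f"
    and green: "\<lbrakk>f \<in> plus_space A; g \<in> plus_space A\<rbrakk> \<Longrightarrow>
      cinner (adj_map A f) g - cinner f (adj_map A g) = \<Gamma>\<^sub>0 f * cnj (\<Gamma>\<^sub>1 g) - \<Gamma>\<^sub>1 f * cnj (\<Gamma>\<^sub>0 g)"
    and surj: "\<exists>f\<in>plus_space A. \<Gamma>\<^sub>0 f = u \<and> \<Gamma>\<^sub>1 f = v"
begin

lemma dense: "densely_defined A"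
  using base by (simp add: base_operator_def)

lemma base_subset_adj: "A \<subseteq> adj_op A"
  using base by (simp add: base_operator_def symmetric_operator_def)

lemma \<Gamma>\<^sub>0_diff: "\<lbrakk>f \<in> plus_space A; g \<in> plus_space A\<rbrakk> \<Longrightarrow> \<Gamma>\<^sub>0 (f - g) = \<Gamma>\<^sub>0 f - \<Gamma>\<^sub>0 g"
  using \<Gamma>\<^sub>0_add[of "f - g" g] plus_space_diff[of f A g] by simp

lemma \<Gamma>\<^sub>1_diff: "\<lbrakk>f \<in> plus_space A; g \<in> plus_space A\<rbrakk> \<Longrightarrow> \<Gamma>\<^sub>1 (f - g) = \<Gamma>\<^sub>1 f - \<Gamma>\<^sub>1 g"
  using \<Gamma>\<^sub>1_add[of "f - g" g] plus_space_diff[of f A g] by simp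

text \<open>For \<open>f\<close> in the domain of \<open>A\<close> the left-hand side of Green's identity vanishes for every \<open>g\<close>, and
  the boundary values of \<open>g\<close> are arbitrary.\<close>

lemma boundary_values_of_base:
  assumes "(f, f') \<in> A"
  shows "f \<in> plus_space A" "f' = adj_map A f" "\<Gamma>\<^sub>0 f = 0" "\<Gamma>\<^sub>1 f = 0"
proof -
  have "(f, f') \<in> adj_op A"
    using assms base_subset_adj by blast
  then show f: "f \<in> plus_space A" "f' = adj_map A f"
    by (simp_all add: adj_op_iff_adj_map[OF dense])
  have zero: "\<Gamma>\<^sub>0 f * cnj (\<Gamma>\<^sub>1 g) - \<Gamma>\<^sub>1 f * cnj (\<Gamma>\<^sub>0 g) = 0" if "g \<in> plus_space A" for g
  proof -
    have "(g, adj_map A g) \<in> adj_op A"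
      using that by (simp add: adj_op_iff_adj_map[OF dense])
    then have "cinner f' g = cinner f (adj_map A g)"
      using assms by (simp add: adj_op_iff)
    then show ?thesis
      using green[OF f(1) that] f(2) by simp
  qed
  show "\<Gamma>\<^sub>0 f = 0"
    using surj[of 0 1] zero by force
  show "\<Gamma>\<^sub>1 f = 0"
    using surj[of 1 0] zero by force
qed

text \<open>The element \<open>\<chi>\<close> of the negative space is independent of the embedded Hilbert space: it is
  non-zero, but vanishes on the dense domain of \<open>A\<close>. Hence an equation in the span of both may be
  solved by comparing coefficients.\<close>

lemma functional_eq_zeroD:
  assumes "\<And>g. g \<in> plus_space A \<Longrightarrow> cinner h g + c * cnj (\<Gamma>\<^sub>0 g) = 0"
  shows "h = 0" "c = 0"
proof -
  have "cinner g h = 0" if "g \<in> Domain A" for g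
    using assms[of g] boundary_values_of_base that cinner_commute[of g h] by force
  then show "h = 0"
    by (rule densely_defined_orthogonal_zero[OF dense])
  then show "c = 0"
    using surj[of 1 0] assms by force
qed

definition main_op :: "'a operator"
  where "main_op = {(f, g) \<in> adj_op A. \<Gamma>\<^sub>1 f + \<i> * \<Gamma>\<^sub>0 f = 0}"

lemma main_op_iff:
  "(f, g) \<in> main_op \<longleftrightarrow> f \<in> plus_space A \<and> g = adj_map A f \<and> \<Gamma>\<^sub>1 f + \<i> * \<Gamma>\<^sub>0 f = 0"
  by (auto simp: main_op_def adj_op_iff_adj_map[OF dense])

text \<open>Green's identity is tested with an element \<open>t\<close> of the domain of the main operator with
  \<open>\<Gamma>\<^sub>0 t = 1\<close>.\<close>

lemma adj_main_opD:
  assumes "(f, g) \<in> adj_op main_op"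
  shows "f \<in> plus_space A" "g = adj_map A f" "\<Gamma>\<^sub>1 f = \<i> * \<Gamma>\<^sub>0 f"
proof -
  have "A \<subseteq> main_op"
    using boundary_values_of_base by (auto simp: main_op_iff)
  then have "(f, g) \<in> adj_op A"
    using assms adj_op_antimono by blast
  then show f: "f \<in> plus_space A" "g = adj_map A f"
    by (simp_all add: adj_op_iff_adj_map[OF dense])
  obtain t where t: "t \<in> plus_space A" "\<Gamma>\<^sub>0 t = 1" "\<Gamma>\<^sub>1 t = - \<i>"
    using surj by blast
  then have "(t, adj_map A t) \<in> main_op"
    by (simp add: main_op_iff)
  then have "cinner (adj_map A t) f = cinner t (adj_map A f)"
    using assms f(2) by (simp add: adj_op_iff)
  then have "cnj (\<Gamma>\<^sub>1 f) + \<i> * cnj (\<Gamma>\<^sub>0 f) = 0"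
    using green[OF t(1) f(1)] t(2,3) by simp
  then have "cnj (\<Gamma>\<^sub>1 f - \<i> * \<Gamma>\<^sub>0 f) = 0"
    by simp
  then show "\<Gamma>\<^sub>1 f = \<i> * \<Gamma>\<^sub>0 f"
    using complex_cnj_zero_iff by (metis eq_iff_diff_eq_0)
qed

definition triple_state_op :: "'a \<Rightarrow> 'a functional"
  where "triple_state_op f = (\<lambda>g. if g \<in> plus_space A
    then cinner (adj_map A f) g + (\<Gamma>\<^sub>1 f + \<i> * \<Gamma>\<^sub>0 f) * cnj (\<Gamma>\<^sub>0 g) else 0)"

definition triple_channel :: "complex \<Rightarrow> 'a functional"
  where "triple_channel e = (\<lambda>g. if g \<in> plus_space A then e * cnj (\<Gamma>\<^sub>0 g) else 0)"

text \<open>The state operators are compared on the positive space only, since an L-system does not restrict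
  their values elsewhere.\<close>

definition realizes :: "'a L_array \<Rightarrow> bool"
  where "realizes \<Theta> \<longleftrightarrow> sym \<Theta> = A \<and> main \<Theta> = main_op \<and>
    (\<forall>f\<in>plus_space A. state_op \<Theta> f = triple_state_op f) \<and> channel \<Theta> = triple_channel"

text \<open>Green's identity turns \<open>(f, A\<^sup>* g)\<close> into \<open>(A\<^sup>* f, g)\<close>, at the cost of boundary terms that change
  \<open>\<Gamma>\<^sub>1 + \<i> \<Gamma>\<^sub>0\<close> into \<open>\<Gamma>\<^sub>1 - \<i> \<Gamma>\<^sub>0\<close>. Real and imaginary part are then read off.\<close>

lemma pm_adj_triple_state_op:
  assumes "f \<in> plus_space A"
  shows "pm_adj A triple_state_op f = (\<lambda>g. if g \<in> plus_space A
    then cinner (adj_map A f) g + (\<Gamma>\<^sub>1 f - \<i> * \<Gamma>\<^sub>0 f) * cnj (\<Gamma>\<^sub>0 g) else 0)"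
proof
  fix g
  show "pm_adj A triple_state_op f g = (if g \<in> plus_space A
    then cinner (adj_map A f) g + (\<Gamma>\<^sub>1 f - \<i> * \<Gamma>\<^sub>0 f) * cnj (\<Gamma>\<^sub>0 g) else 0)"
  proof (cases "g \<in> plus_space A")
    case True
    have "cnj (cinner (adj_map A g) f) = cinner f (adj_map A g)"
      using cinner_commute by metis
    then show ?thesis
      using True assms green[OF assms True]
      by (simp add: pm_adj_def triple_state_op_def algebra_simps)
  qed (simp add: pm_adj_def)
qed

lemma pm_Re_triple_state_op:
  assumes "f \<in> plus_space A"
  shows "pm_Re A triple_state_op f = (\<lambda>g. if g \<in> plus_space A
    then cinner (adj_map A f) g + \<Gamma>\<^sub>1 f * cnj (\<Gamma>\<^sub>0 g) else 0)"
  unfolding pm_Re_def pm_adj_triple_state_op[OF assms]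
  by (auto simp: triple_state_op_def algebra_simps)

lemma pm_Im_triple_state_op:
  assumes "f \<in> plus_space A"
  shows "pm_Im A triple_state_op f = triple_channel (\<Gamma>\<^sub>0 f)"
  unfolding pm_Im_def pm_adj_triple_state_op[OF assms]
  by (auto simp: triple_state_op_def triple_channel_def fun_eq_iff algebra_simps)

lemma quasi_kernel_Re_triple_state_op:
  "quasi_kernel A (pm_Re A triple_state_op) = {(f, g) \<in> adj_op A. \<Gamma>\<^sub>1 f = 0}"
proof -
  have "pm_Re A triple_state_op f = embed A h \<longleftrightarrow> h = adj_map A f \<and> \<Gamma>\<^sub>1 f = 0"
    if f: "f \<in> plus_space A" for f h
  proof
    assume eq: "pm_Re A triple_state_op f = embed A h"
    have "cinner (adj_map A f - h) g + \<Gamma>\<^sub>1 f * cnj (\<Gamma>\<^sub>0 g) = 0" if "g \<in> plus_space A" for g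
      using fun_cong[OF eq, of g] that
      by (simp add: pm_Re_triple_state_op[OF f] embed_def cinner_diff_left algebra_simps)
    then show "h = adj_map A f \<and> \<Gamma>\<^sub>1 f = 0"
      using functional_eq_zeroD[of "adj_map A f - h" "\<Gamma>\<^sub>1 f"] by auto
  qed (auto simp: pm_Re_triple_state_op[OF f] embed_def)
  then show ?thesis
    by (auto simp: quasi_kernel_def adj_op_iff_adj_map[OF dense])
qed

text \<open>The condition \<open>\<Gamma>\<^sub>1 f = 0\<close> describes a Lagrangian subspace of boundary values: the right-hand side
  of Green's identity vanishes on it, and testing with \<open>h\<close> such that \<open>\<Gamma>\<^sub>0 h = 1\<close> and
  \<open>\<Gamma>\<^sub>1 h = 0\<close> shows that it is maximal.\<close>

lemma self_adjoint_kernel_\<Gamma>\<^sub>1: "self_adjoint_in UNIV {(f, g) \<in> adj_op A. \<Gamma>\<^sub>1 f = 0}"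
proof -
  define S where "S = {(f, g) \<in> adj_op A. \<Gamma>\<^sub>1 f = 0}"
  have S_iff: "(f, g) \<in> S \<longleftrightarrow> f \<in> plus_space A \<and> g = adj_map A f \<and> \<Gamma>\<^sub>1 f = 0" for f g
    by (auto simp: S_def adj_op_iff_adj_map[OF dense])
  have AS: "A \<subseteq> S"
    using boundary_values_of_base by (auto simp: S_iff)
  have "complex_vector.subspace S"
    using boundary_values_of_base \<Gamma>\<^sub>1_scaleC[OF plus_space_zero, of 0]
    by (intro complex_vector.subspaceI)
      (auto simp: S_def zero_prod_def scaleC_prod_def adj_op_iff_adj_map[OF dense] plus_space_zero
        plus_space_add plus_space_scaleC adj_map_add[OF dense] adj_map_scaleC[OF dense]
        adj_map_eq[OF dense adj_op_zero] \<Gamma>\<^sub>1_add \<Gamma>\<^sub>1_scaleC)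
  then have "linear_operator S"
    by (auto simp: linear_operator_def single_valued_def S_iff)
  moreover have "closure (Domain S) = UNIV"
    using closure_mono[OF Domain_mono[OF AS]] dense by (auto simp: densely_defined_def)
  moreover have "adj_op S = S"
  proof (intro equalityI subrelI)
    fix f g assume fg: "(f, g) \<in> adj_op S"
    then have f: "f \<in> plus_space A" "g = adj_map A f"
      using adj_op_antimono[OF AS] by (auto simp: adj_op_iff_adj_map[OF dense])
    obtain h where h: "h \<in> plus_space A" "\<Gamma>\<^sub>0 h = 1" "\<Gamma>\<^sub>1 h = 0"
      using surj by blast
    then have "(h, adj_map A h) \<in> S"
      by (simp add: S_iff)
    then have "cinner (adj_map A h) f = cinner h (adj_map A f)"
      using fg f(2) by (simp add: adj_op_iff)
    then show "(f, g) \<in> S"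
      using green[OF h(1) f(1)] h f by (simp add: S_iff)
  next
    fix f g assume "(f, g) \<in> S"
    then show "(f, g) \<in> adj_op S"
      using green by (force simp: adj_op_iff S_iff)
  qed
  ultimately show ?thesis
    by (simp add: self_adjoint_in_def S_def)
qed

lemma minus_spaceI:
  assumes "\<And>f. \<phi> f = (if f \<in> plus_space A then cinner h f + c * cnj (\<Gamma>\<^sub>0 f) else 0)"
  shows "\<phi> \<in> minus_space A"
proof -
  obtain C where C: "\<And>f. f \<in> plus_space A \<Longrightarrow> cmod (\<Gamma>\<^sub>0 f) \<le> C * plus_norm A f"
    using \<Gamma>\<^sub>0_bounded by blast
  have "cmod (\<phi> f) \<le> (norm h + cmod c * C) * plus_norm A f" if f: "f \<in> plus_space A" for f
  proof -
    have "cmod (\<phi> f) \<le> norm h * norm f + cmod c * cmod (\<Gamma>\<^sub>0 f)"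
      using f norm_triangle_ineq[of "cinner h f" "c * cnj (\<Gamma>\<^sub>0 f)"] cauchy_schwarz[of h f]
      by (simp add: assms norm_mult)
    also have "\<dots> \<le> norm h * plus_norm A f + cmod c * (C * plus_norm A f)"
      using norm_le_plus_norm C[OF f] by (intro add_mono mult_left_mono) auto
    finally show ?thesis
      by (simp add: algebra_simps)
  qed
  then have "\<exists>C. \<forall>f\<in>plus_space A. cmod (\<phi> f) \<le> C * plus_norm A f"
    by blast
  then show ?thesis
    unfolding minus_space_def mem_Collect_eq
    by (intro conjI) (simp_all add: assms plus_space_add plus_space_scaleC \<Gamma>\<^sub>0_add \<Gamma>\<^sub>0_scaleC cinner_algebra
        algebra_simps)
qed

lemma bounded_triple_channel: "bounded_complex_minus A triple_channel"
proof -
  obtain C where C: "\<And>f. f \<in> plus_space A \<Longrightarrow> cmod (\<Gamma>\<^sub>0 f) \<le> C * plus_norm A f"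
    using \<Gamma>\<^sub>0_bounded by blast
  have "minus_norm A (triple_channel e) \<le> \<bar>C\<bar> * cmod e" for e
  proof (rule minus_norm_le[OF dense])
    fix f assume f: "f \<in> plus_space A"
    have "cmod (\<Gamma>\<^sub>0 f) \<le> \<bar>C\<bar> * plus_norm A f"
      using C[OF f] mult_right_mono[OF abs_ge_self plus_norm_nonneg, of C A f] by linarith
    then show "cmod (triple_channel e f) \<le> \<bar>C\<bar> * cmod e * plus_norm A f"
      using f mult_left_mono[of "cmod (\<Gamma>\<^sub>0 f)" "\<bar>C\<bar> * plus_norm A f" "cmod e"]
      by (simp add: triple_channel_def norm_mult algebra_simps)
  qed simp
  moreover have "triple_channel e \<in> minus_space A" for e
    by (rule minus_spaceI[of _ 0 e]) (simp add: triple_channel_def)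
  ultimately show ?thesis
    unfolding bounded_complex_minus_def
    by (auto simp: triple_channel_def fun_eq_iff algebra_simps)
qed

lemma bounded_triple_state_op: "bounded_plus_minus A triple_state_op"
proof -
  obtain C0 where C0: "\<And>f. f \<in> plus_space A \<Longrightarrow> cmod (\<Gamma>\<^sub>0 f) \<le> C0 * plus_norm A f"
    using \<Gamma>\<^sub>0_bounded by blast
  obtain C1 where C1: "\<And>f. f \<in> plus_space A \<Longrightarrow> cmod (\<Gamma>\<^sub>1 f) \<le> C1 * plus_norm A f"
    using \<Gamma>\<^sub>1_bounded by blast
  define D where "D = \<bar>C0\<bar> + \<bar>C1\<bar>"
  have D: "cmod (\<Gamma>\<^sub>0 f) \<le> D * plus_norm A f" "cmod (\<Gamma>\<^sub>1 f + \<i> * \<Gamma>\<^sub>0 f) \<le> D * plus_norm A f"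
    if f: "f \<in> plus_space A" for f
  proof -
    have "cmod (\<Gamma>\<^sub>0 f) \<le> \<bar>C0\<bar> * plus_norm A f" "cmod (\<Gamma>\<^sub>1 f) \<le> \<bar>C1\<bar> * plus_norm A f"
      using C0[OF f] C1[OF f] mult_right_mono[OF abs_ge_self plus_norm_nonneg, of C0 A f]
        mult_right_mono[OF abs_ge_self plus_norm_nonneg, of C1 A f] by linarith+
    moreover have "0 \<le> \<bar>C1\<bar> * plus_norm A f"
      by (simp add: plus_norm_nonneg)
    moreover have "cmod (\<Gamma>\<^sub>1 f + \<i> * \<Gamma>\<^sub>0 f) \<le> cmod (\<Gamma>\<^sub>1 f) + cmod (\<Gamma>\<^sub>0 f)"
      using norm_triangle_ineq[of "\<Gamma>\<^sub>1 f" "\<i> * \<Gamma>\<^sub>0 f"] by (simp add: norm_mult)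
    ultimately show "cmod (\<Gamma>\<^sub>0 f) \<le> D * plus_norm A f"
      "cmod (\<Gamma>\<^sub>1 f + \<i> * \<Gamma>\<^sub>0 f) \<le> D * plus_norm A f"
      unfolding D_def distrib_right by linarith+
  qed
  have "minus_norm A (triple_state_op f) \<le> (1 + D * D) * plus_norm A f"
    if f: "f \<in> plus_space A" for f
  proof (rule minus_norm_le[OF dense])
    show "0 \<le> (1 + D * D) * plus_norm A f"
      by (simp add: plus_norm_nonneg)
    fix g assume g: "g \<in> plus_space A"
    have "cmod (triple_state_op f g) \<le>
        norm (adj_map A f) * norm g + cmod (\<Gamma>\<^sub>1 f + \<i> * \<Gamma>\<^sub>0 f) * cmod (\<Gamma>\<^sub>0 g)"
      using g norm_triangle_ineq[of "cinner (adj_map A f) g" "(\<Gamma>\<^sub>1 f + \<i> * \<Gamma>\<^sub>0 f) * cnj (\<Gamma>\<^sub>0 g)"]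
        cauchy_schwarz[of "adj_map A f" g]
      by (simp add: triple_state_op_def norm_mult)
    also have "\<dots> \<le> plus_norm A f * plus_norm A g + (D * plus_norm A f) * (D * plus_norm A g)"
      using order_trans[OF norm_ge_zero D(1)[OF f]]
      by (intro add_mono mult_mono D f g norm_le_plus_norm norm_adj_map_le_plus_norm)
        (auto simp: plus_norm_nonneg)
    finally show "cmod (triple_state_op f g) \<le> (1 + D * D) * plus_norm A f * plus_norm A g"
      by (simp add: algebra_simps)
  qed
  then have "\<exists>C. \<forall>f\<in>plus_space A. minus_norm A (triple_state_op f) \<le> C * plus_norm A f"
    by blast
  moreover have "triple_state_op f \<in> minus_space A" if "f \<in> plus_space A" for f
    by (rule minus_spaceI) (simp add: triple_state_op_def)
  ultimately show ?thesis
    unfolding bounded_plus_minus_def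
    by (intro conjI ballI allI; assumption?) (auto simp: triple_state_op_def fun_eq_iff adj_map_add[OF dense] adj_map_scaleC[OF dense]
        \<Gamma>\<^sub>0_add \<Gamma>\<^sub>1_add \<Gamma>\<^sub>0_scaleC \<Gamma>\<^sub>1_scaleC cinner_algebra algebra_simps)
qed

definition triple_system :: "'a L_array"
  where "triple_system =
    \<lparr>sym = A, main = main_op, state_op = triple_state_op, channel = triple_channel\<rparr>"

lemma realizes_triple_system: "realizes triple_system"
  by (simp add: realizes_def triple_system_def)

lemma K_adj_triple_channel: "f \<in> plus_space A \<Longrightarrow> K_adj triple_channel f = \<Gamma>\<^sub>0 f"
  by (simp add: K_adj_def triple_channel_def)

lemma L_system_triple_system:
  assumes "main_op \<in> Lambda_class A"
  shows "L_system triple_system"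
proof -
  have "A \<subseteq> adj_op main_op"
  proof (intro subrelI)
    fix f f' assume f: "(f, f') \<in> A"
    have "cinner t' f = cinner t f'" if "(t, t') \<in> main_op" for t t'
    proof -
      have "cinner f' t = cinner f t'"
        using f that by (auto simp: main_op_def adj_op_iff)
      then show ?thesis
        using cinner_commute by metis
    qed
    then show "(f, f') \<in> adj_op main_op"
      by (simp add: adj_op_iff)
  qed
  moreover have "A \<subseteq> main_op"
    using boundary_values_of_base by (auto simp: main_op_iff)
  moreover have "extends_op A triple_state_op main_op"
    by (auto simp: extends_op_def main_op_iff triple_state_op_def embed_def)
  moreover have "extends_op A (pm_adj A triple_state_op) (adj_op main_op)"
    unfolding extends_op_def
    using adj_main_opD by (auto simp: pm_adj_triple_state_op embed_def fun_eq_iff)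
  moreover have "self_adjoint_in UNIV (quasi_kernel A (pm_Re A triple_state_op))"
    unfolding quasi_kernel_Re_triple_state_op by (rule self_adjoint_kernel_\<Gamma>\<^sub>1)
  ultimately have star: "star_extension A main_op triple_state_op"
    using bounded_triple_state_op by (simp add: star_extension_def)
  have "range triple_channel = pm_Im A triple_state_op ` plus_space A"
  proof -
    have "u \<in> \<Gamma>\<^sub>0 ` plus_space A" for u
      using surj[of u 0] by blast
    then have "\<Gamma>\<^sub>0 ` plus_space A = UNIV"
      by blast
    then have "range triple_channel = triple_channel ` \<Gamma>\<^sub>0 ` plus_space A"
      by simp
    also have "\<dots> = pm_Im A triple_state_op ` plus_space A"
      by (simp add: image_image pm_Im_triple_state_op)
    finally show ?thesis .
  qed
  then show ?thesis
    using star assms base bounded_triple_channel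
    by (simp add: L_system_def triple_system_def pm_Im_triple_state_op K_adj_triple_channel)
qed

text \<open>Take any element of the positive space on which \<open>\<Gamma>\<^sub>1 + \<i> \<Gamma>\<^sub>0\<close> is 1 and subtract an element of the
  domain of the main operator, where that functional vanishes, to cancel \<open>(A\<^sup>* - z) f\<close>.\<close>

lemma deficiency_element:
  assumes "z \<in> resolvent_set main_op"
  obtains x where "x \<in> plus_space A" "adj_map A x = z *\<^sub>C x" "\<Gamma>\<^sub>1 x + \<i> * \<Gamma>\<^sub>0 x = 1"
proof -
  obtain f where f: "f \<in> plus_space A" "\<Gamma>\<^sub>0 f = 0" "\<Gamma>\<^sub>1 f = 1"
    using surj by blast
  obtain t where "(t, (adj_map A f - z *\<^sub>C f) + z *\<^sub>C t) \<in> main_op"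
    using assms unfolding resolvent_set_def by blast
  then have t: "t \<in> plus_space A" "(adj_map A f - z *\<^sub>C f) + z *\<^sub>C t = adj_map A t"
    "\<Gamma>\<^sub>1 t + \<i> * \<Gamma>\<^sub>0 t = 0"
    by (simp_all add: main_op_iff)
  show thesis
  proof (rule that[of "f - t"])
    show "f - t \<in> plus_space A"
      using f(1) t(1) by (rule plus_space_diff)
    show "adj_map A (f - t) = z *\<^sub>C (f - t)"
      using f t by (simp add: adj_map_diff[OF dense] complex_vector.scale_right_diff_distrib
          t(2)[symmetric])
    have "\<Gamma>\<^sub>1 (f - t) + \<i> * \<Gamma>\<^sub>0 (f - t) = 1 - (\<Gamma>\<^sub>1 t + \<i> * \<Gamma>\<^sub>0 t)"
      using f t(1) by (simp add: \<Gamma>\<^sub>0_diff \<Gamma>\<^sub>1_diff right_diff_distrib)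
    then show "\<Gamma>\<^sub>1 (f - t) + \<i> * \<Gamma>\<^sub>0 (f - t) = 1"
      using t(3) by simp
  qed
qed

text \<open>Comparing coefficients, \<open>A\<^sup>* y + (\<Gamma>\<^sub>1 y + \<i> \<Gamma>\<^sub>0 y) \<chi> - z y = e \<chi>\<close> means that \<open>y\<close> lies in
  \<open>ker (A\<^sup>* - z)\<close> and \<open>\<Gamma>\<^sub>1 y + \<i> \<Gamma>\<^sub>0 y = e\<close>. The main operator maps the difference of
  two such elements to its \<open>z\<close>-fold; the difference is 0 because \<open>z\<close> is in the resolvent set.\<close>

lemma realized_solution_iff:
  assumes "realizes \<Theta>" "z \<in> resolvent_set main_op"
    and x: "x \<in> plus_space A" "adj_map A x = z *\<^sub>C x" "\<Gamma>\<^sub>1 x + \<i> * \<Gamma>\<^sub>0 x = 1"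
  shows "y \<in> plus_space (sym \<Theta>) \<and>
      (\<lambda>g. state_op \<Theta> y g - z * embed (sym \<Theta>) y g) = channel \<Theta> e \<longleftrightarrow> y = e *\<^sub>C x"
    (is "?sol \<longleftrightarrow> _")
proof -
  have sol: "?sol \<longleftrightarrow> y \<in> plus_space A \<and> (\<forall>g\<in>plus_space A.
      cinner (adj_map A y - z *\<^sub>C y) g + (\<Gamma>\<^sub>1 y + \<i> * \<Gamma>\<^sub>0 y - e) * cnj (\<Gamma>\<^sub>0 g) = 0)"
    using assms(1)
    by (auto simp: realizes_def triple_state_op_def triple_channel_def embed_def fun_eq_iff
        cinner_algebra algebra_simps)
  show ?thesis
  proof
    assume ?sol
    then have y: "y \<in> plus_space A" "adj_map A y - z *\<^sub>C y = 0" "\<Gamma>\<^sub>1 y + \<i> * \<Gamma>\<^sub>0 y - e = 0"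
      unfolding sol using functional_eq_zeroD by blast+
    define d where "d = y - e *\<^sub>C x"
    have ex: "e *\<^sub>C x \<in> plus_space A"
      using x(1) by (rule plus_space_scaleC)
    have "\<Gamma>\<^sub>1 d + \<i> * \<Gamma>\<^sub>0 d = (\<Gamma>\<^sub>1 y + \<i> * \<Gamma>\<^sub>0 y) - e * (\<Gamma>\<^sub>1 x + \<i> * \<Gamma>\<^sub>0 x)"
      using y(1) ex x(1) by (simp add: d_def \<Gamma>\<^sub>0_diff \<Gamma>\<^sub>1_diff \<Gamma>\<^sub>0_scaleC \<Gamma>\<^sub>1_scaleC algebra_simps)
    then have "\<Gamma>\<^sub>1 d + \<i> * \<Gamma>\<^sub>0 d = 0"
      using x(3) y(3) by simp
    moreover have "adj_map A d = z *\<^sub>C d"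
      using y ex x by (simp add: d_def adj_map_diff[OF dense] adj_map_scaleC[OF dense]
          complex_vector.scale_right_diff_distrib scaleC_scaleC mult.commute)
    ultimately have "(d, 0 + z *\<^sub>C d) \<in> main_op"
      using y(1) ex by (simp add: main_op_iff d_def plus_space_diff)
    moreover have "(0, 0 + z *\<^sub>C 0) \<in> main_op"
      using \<Gamma>\<^sub>0_scaleC[OF plus_space_zero, of 0] \<Gamma>\<^sub>1_scaleC[OF plus_space_zero, of 0]
        adj_map_eq[OF dense adj_op_zero]
      by (simp add: main_op_iff plus_space_zero)
    ultimately have "d = 0"
      using assms(2) unfolding resolvent_set_def by blast
    then show "y = e *\<^sub>C x"
      by (simp add: d_def)
  next
    assume y: "y = e *\<^sub>C x"
    have "\<Gamma>\<^sub>1 y + \<i> * \<Gamma>\<^sub>0 y - e = e * (\<Gamma>\<^sub>1 x + \<i> * \<Gamma>\<^sub>0 x) - e"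
      using x(1) by (simp add: y \<Gamma>\<^sub>0_scaleC \<Gamma>\<^sub>1_scaleC algebra_simps)
    moreover have "adj_map A y - z *\<^sub>C y = 0"
      using x by (simp add: y adj_map_scaleC[OF dense] scaleC_scaleC mult.commute)
    ultimately show ?sol
      unfolding sol using x by (simp add: y plus_space_scaleC)
  qed
qed

text \<open>The quotient does not depend on the scaling of \<open>x\<close>; thus the same vector may be used for all
  boundary triples that share the main operator.\<close>

lemma realized_transfer:
  assumes "realizes \<Theta>" "z \<in> resolvent_set main_op"
    and x: "x \<in> plus_space A" "adj_map A x = z *\<^sub>C x" "\<Gamma>\<^sub>1 x + \<i> * \<Gamma>\<^sub>0 x \<noteq> 0"
  shows "L_transfer \<Theta> z e = e * ((\<Gamma>\<^sub>1 x - \<i> * \<Gamma>\<^sub>0 x) / (\<Gamma>\<^sub>1 x + \<i> * \<Gamma>\<^sub>0 x))"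
proof -
  define c where "c = \<Gamma>\<^sub>1 x + \<i> * \<Gamma>\<^sub>0 x"
  define x' where "x' = (1 / c) *\<^sub>C x"
  have c: "c \<noteq> 0"
    using x(3) by (simp add: c_def)
  have x': "x' \<in> plus_space A" "adj_map A x' = z *\<^sub>C x'"
    using x by (simp_all add: x'_def plus_space_scaleC adj_map_scaleC[OF dense] scaleC_scaleC
        mult.commute)
  have "\<Gamma>\<^sub>1 x' + \<i> * \<Gamma>\<^sub>0 x' = (1 / c) * (\<Gamma>\<^sub>1 x + \<i> * \<Gamma>\<^sub>0 x)"
    using x(1) unfolding x'_def by (simp only: \<Gamma>\<^sub>0_scaleC \<Gamma>\<^sub>1_scaleC) (simp only: algebra_simps)
  then have "\<Gamma>\<^sub>1 x' + \<i> * \<Gamma>\<^sub>0 x' = (1 / c) * c"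
    by (simp only: c_def)
  then have "\<Gamma>\<^sub>1 x' + \<i> * \<Gamma>\<^sub>0 x' = 1"
    using c by simp
  from realized_solution_iff[OF assms(1,2) x' this]
  have "L_solution \<Theta> z (channel \<Theta> e) = e *\<^sub>C x'"
    unfolding L_solution_def by simp
  then have "L_transfer \<Theta> z e = e - 2 * \<i> * (e * (\<Gamma>\<^sub>0 x / c))"
    using assms(1) x'(1) x(1)
    by (simp add: L_transfer_def realizes_def K_adj_triple_channel plus_space_scaleC \<Gamma>\<^sub>0_scaleC)
      (simp add: x'_def \<Gamma>\<^sub>0_scaleC)
  also have "\<dots> = e * ((c - 2 * \<i> * \<Gamma>\<^sub>0 x) / c)"
    using c by (simp add: field_simps)
  also have "c - 2 * \<i> * \<Gamma>\<^sub>0 x = \<Gamma>\<^sub>1 x - \<i> * \<Gamma>\<^sub>0 x"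
    by (simp add: c_def)
  finally show ?thesis
    by (simp add: c_def)
qed

lemma rotated_boundary_triple:
  fixes s c :: real
  assumes "s\<^sup>2 + c\<^sup>2 = 1"
  shows "boundary_triple A (\<lambda>f. s * \<Gamma>\<^sub>0 f + c * \<Gamma>\<^sub>1 f) (\<lambda>f. s * \<Gamma>\<^sub>1 f - c * \<Gamma>\<^sub>0 f)"
proof
  have sc: "complex_of_real s * s + complex_of_real c * c = 1"
    using arg_cong[OF assms, of complex_of_real] by (simp add: power2_eq_square)
  have bounded: "\<exists>C. \<forall>f\<in>plus_space A. cmod (p * \<Gamma>\<^sub>0 f + q * \<Gamma>\<^sub>1 f) \<le> C * plus_norm A f" for p q
  proof -
    obtain C0 where C0: "\<And>f. f \<in> plus_space A \<Longrightarrow> cmod (\<Gamma>\<^sub>0 f) \<le> C0 * plus_norm A f"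
      using \<Gamma>\<^sub>0_bounded by blast
    obtain C1 where C1: "\<And>f. f \<in> plus_space A \<Longrightarrow> cmod (\<Gamma>\<^sub>1 f) \<le> C1 * plus_norm A f"
      using \<Gamma>\<^sub>1_bounded by blast
    have "cmod (p * \<Gamma>\<^sub>0 f + q * \<Gamma>\<^sub>1 f) \<le> (cmod p * C0 + cmod q * C1) * plus_norm A f"
      if f: "f \<in> plus_space A" for f
    proof -
      have "cmod (p * \<Gamma>\<^sub>0 f + q * \<Gamma>\<^sub>1 f) \<le> cmod p * cmod (\<Gamma>\<^sub>0 f) + cmod q * cmod (\<Gamma>\<^sub>1 f)"
        by (metis norm_triangle_ineq norm_mult)
      also have "\<dots> \<le> cmod p * (C0 * plus_norm A f) + cmod q * (C1 * plus_norm A f)"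
        by (intro add_mono mult_left_mono C0[OF f] C1[OF f]) simp_all
      finally show ?thesis
        by (simp add: algebra_simps)
    qed
    then show ?thesis
      by blast
  qed
  show "\<exists>C. \<forall>f\<in>plus_space A. cmod (s * \<Gamma>\<^sub>0 f + c * \<Gamma>\<^sub>1 f) \<le> C * plus_norm A f"
    by (rule bounded)
  show "\<exists>C. \<forall>f\<in>plus_space A. cmod (s * \<Gamma>\<^sub>1 f - c * \<Gamma>\<^sub>0 f) \<le> C * plus_norm A f"
    using bounded[of "- complex_of_real c" "complex_of_real s"] by simp
  show "base_operator A"
    by (rule base)
  show "cinner (adj_map A f) g - cinner f (adj_map A g) =
      (s * \<Gamma>\<^sub>0 f + c * \<Gamma>\<^sub>1 f) * cnj (s * \<Gamma>\<^sub>1 g - c * \<Gamma>\<^sub>0 g) -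
      (s * \<Gamma>\<^sub>1 f - c * \<Gamma>\<^sub>0 f) * cnj (s * \<Gamma>\<^sub>0 g + c * \<Gamma>\<^sub>1 g)"
    if "f \<in> plus_space A" "g \<in> plus_space A" for f g
  proof -
    have "(s * \<Gamma>\<^sub>0 f + c * \<Gamma>\<^sub>1 f) * cnj (s * \<Gamma>\<^sub>1 g - c * \<Gamma>\<^sub>0 g) -
        (s * \<Gamma>\<^sub>1 f - c * \<Gamma>\<^sub>0 f) * cnj (s * \<Gamma>\<^sub>0 g + c * \<Gamma>\<^sub>1 g) =
        (complex_of_real s * s + complex_of_real c * c) *
        (\<Gamma>\<^sub>0 f * cnj (\<Gamma>\<^sub>1 g) - \<Gamma>\<^sub>1 f * cnj (\<Gamma>\<^sub>0 g))"
      by (simp add: algebra_simps)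
    then show ?thesis
      using green[OF that] by (simp add: sc)
  qed
  show "\<exists>f\<in>plus_space A. s * \<Gamma>\<^sub>0 f + c * \<Gamma>\<^sub>1 f = u \<and> s * \<Gamma>\<^sub>1 f - c * \<Gamma>\<^sub>0 f = v" for u v
  proof -
    \<comment> \<open>the inverse rotation of \<open>(u, v)\<close>\<close>
    obtain f where f: "f \<in> plus_space A" "\<Gamma>\<^sub>0 f = s * u - c * v" "\<Gamma>\<^sub>1 f = c * u + s * v"
      using surj by blast
    have "s * \<Gamma>\<^sub>0 f + c * \<Gamma>\<^sub>1 f = (complex_of_real s * s + complex_of_real c * c) * u"
      "s * \<Gamma>\<^sub>1 f - c * \<Gamma>\<^sub>0 f = (complex_of_real s * s + complex_of_real c * c) * v"
      unfolding f by (simp_all add: algebra_simps)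
    then show ?thesis
      using f(1) sc by auto
  qed
qed (simp_all add: \<Gamma>\<^sub>0_add \<Gamma>\<^sub>1_add \<Gamma>\<^sub>0_scaleC \<Gamma>\<^sub>1_scaleC algebra_simps)

end

text \<open>The rotation angle is \<open>pi / 2 - \<alpha>\<close>. The two unimodular factors have the quotient
  \<open>- exp (2 \<i> \<alpha>)\<close>.\<close>

lemma rotated_combinations:
  fixes a b :: complex and \<alpha> :: real
  shows "(sin \<alpha> * b - cos \<alpha> * a) + \<i> * (sin \<alpha> * a + cos \<alpha> * b) = \<i> * exp (- (\<i> * \<alpha>)) * (b + \<i> * a)"
    and "(sin \<alpha> * b - cos \<alpha> * a) - \<i> * (sin \<alpha> * a + cos \<alpha> * b) = - \<i> * exp (\<i> * \<alpha>) * (b - \<i> * a)"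
proof -
  have e: "exp (\<i> * \<alpha>) = cos \<alpha> + \<i> * sin \<alpha>" "exp (- (\<i> * \<alpha>)) = cos \<alpha> - \<i> * sin \<alpha>"
    by (simp_all add: exp_Euler exp_minus_Euler cos_of_real sin_of_real)
  show "(sin \<alpha> * b - cos \<alpha> * a) + \<i> * (sin \<alpha> * a + cos \<alpha> * b) =
      \<i> * exp (- (\<i> * \<alpha>)) * (b + \<i> * a)"
    unfolding e by (simp add: algebra_simps)
  show "(sin \<alpha> * b - cos \<alpha> * a) - \<i> * (sin \<alpha> * a + cos \<alpha> * b) =
      - \<i> * exp (\<i> * \<alpha>) * (b - \<i> * a)"
    unfolding e by (simp add: algebra_simps)
qed


section \<open>The boundary triple of an L-system\<close>

locale l_system =
  fixes \<Theta> :: "'a::complex_hilbert L_array"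
  assumes system: "L_system \<Theta>"
begin

abbreviation "A \<equiv> sym \<Theta>"
abbreviation "T \<equiv> main \<Theta>"
abbreviation "B \<equiv> state_op \<Theta>"

text \<open>The functional \<open>K\<^sup>*\<close>, which is to become \<open>\<Gamma>\<^sub>0\<close>.\<close>

definition k :: "'a \<Rightarrow> complex"
  where "k = K_adj (channel \<Theta>)"

lemma dense: "densely_defined A"
  using system by (simp add: L_system_def base_operator_def)

lemma linear_T: "linear_operator T"
  and not_symmetric_T: "\<not> symmetric_operator T"
  and A_subset_T: "A \<subseteq> T"
  and T_subset_adj_A: "T \<subseteq> adj_op A"
  and resolvent_nonempty: "resolvent_set T \<noteq> {}"
  and Domain_A: "Domain A = Domain T \<inter> Domain (adj_op T)"
  using system by (auto simp: L_system_def Lambda_class_def quasi_self_adjoint_extension_def)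

lemma bounded_B: "bounded_plus_minus A B"
  and extends_B: "extends_op A B T"
  and extends_adj_B: "extends_op A (pm_adj A B) (adj_op T)"
  and A_subset_adj_T: "A \<subseteq> adj_op T"
  and self_adjoint_quasi_kernel: "self_adjoint_in UNIV (quasi_kernel A (pm_Re A B))"
  using system by (auto simp: L_system_def star_extension_def)

lemma adj_T_subset_adj_A: "adj_op T \<subseteq> adj_op A"
  using A_subset_T by (rule adj_op_antimono)

lemma in_adj_A_iff: "(f, g) \<in> adj_op A \<longleftrightarrow> f \<in> plus_space A \<and> g = adj_map A f"
  by (rule adj_op_iff_adj_map[OF dense])

lemma T_D: "(f, g) \<in> T \<Longrightarrow> f \<in> plus_space A \<and> g = adj_map A f"
  using T_subset_adj_A in_adj_A_iff by blast

lemma adj_T_D: "(f, g) \<in> adj_op T \<Longrightarrow> f \<in> plus_space A \<and> g = adj_map A f"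
  using adj_T_subset_adj_A in_adj_A_iff by blast

lemma A_D: "(f, g) \<in> A \<Longrightarrow> f \<in> plus_space A \<and> g = adj_map A f"
  using A_subset_T T_D by blast

lemma B_outside: "f \<in> plus_space A \<Longrightarrow> g \<notin> plus_space A \<Longrightarrow> B f g = 0"
  using bounded_B by (auto simp: bounded_plus_minus_def minus_space_def)

lemma B_add_left: "\<lbrakk>f \<in> plus_space A; g \<in> plus_space A\<rbrakk> \<Longrightarrow> B (f + g) h = B f h + B g h"
  using bounded_B by (simp add: bounded_plus_minus_def)

lemma B_scaleC_left: "f \<in> plus_space A \<Longrightarrow> B (c *\<^sub>C f) h = c * B f h"
  using bounded_B by (simp add: bounded_plus_minus_def)

lemma B_diff_left: "\<lbrakk>f \<in> plus_space A; g \<in> plus_space A\<rbrakk> \<Longrightarrow> B (f - g) h = B f h - B g h"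
  using B_add_left[of "f - g" g h] plus_space_diff[of f A g] by simp

lemma channel_minus: "channel \<Theta> e \<in> minus_space A"
  using system by (simp add: L_system_def bounded_complex_minus_def)

lemma channel_eq: "channel \<Theta> e g = e * cnj (k g)"
proof -
  have "bounded_complex_minus A (channel \<Theta>)"
    using system by (simp add: L_system_def)
  from K_adj_pairing[OF this] show ?thesis
    by (simp add: k_def cinner_complex_def)
qed

lemma channel_outside: "g \<notin> plus_space A \<Longrightarrow> channel \<Theta> e g = 0"
  using channel_minus[of e] by (simp add: minus_space_def)

lemma k_add: "\<lbrakk>f \<in> plus_space A; g \<in> plus_space A\<rbrakk> \<Longrightarrow> k (f + g) = k f + k g"
  using channel_minus[of 1] by (simp add: minus_space_def k_def K_adj_def)

lemma k_scaleC: "f \<in> plus_space A \<Longrightarrow> k (c *\<^sub>C f) = c * k f"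
  using channel_minus[of 1] by (simp add: minus_space_def k_def K_adj_def)

lemma k_bounded: "\<exists>C. \<forall>f\<in>plus_space A. cmod (k f) \<le> C * plus_norm A f"
  using channel_minus[of 1] by (simp add: minus_space_def k_def K_adj_def)

lemma imaginary_part:
  assumes "f \<in> plus_space A" "g \<in> plus_space A"
  shows "B f g - cnj (B g f) = 2 * \<i> * (k f * cnj (k g))"
proof -
  have "pm_Im A B f = channel \<Theta> (k f)"
    using system assms(1) by (simp add: L_system_def k_def)
  then have "pm_Im A B f g = k f * cnj (k g)"
    by (simp add: channel_eq)
  then show ?thesis
    using assms(1,2) by (simp add: pm_Im_def pm_adj_def field_simps)
qed

lemma B_on_T: "(f, g) \<in> T \<Longrightarrow> h \<in> plus_space A \<Longrightarrow> B f h = cinner g h"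
  using extends_B by (auto simp: extends_op_def embed_def)

lemma B_adj_T:
  assumes "(f, g) \<in> adj_op T" "h \<in> plus_space A"
  shows "B h f = cinner h g"
proof -
  have "f \<in> plus_space A" and "pm_adj A B f = embed A g"
    using extends_adj_B assms(1) by (auto simp: extends_op_def)
  from fun_cong[OF this(2), of h] have "cnj (B h f) = cinner g h"
    using assms(2) by (simp add: pm_adj_def embed_def)
  then show ?thesis
    by (metis cinner_commute complex_cnj_cnj)
qed

lemma B_on_base: "\<lbrakk>g \<in> Domain A; f \<in> plus_space A\<rbrakk> \<Longrightarrow> B f g = cinner (adj_map A f) g"
proof -
  assume g: "g \<in> Domain A" and f: "f \<in> plus_space A"
  obtain g' where g': "(g, g') \<in> A"
    using g by blast
  have "(f, adj_map A f) \<in> adj_op A"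
    using f by (simp add: in_adj_A_iff)
  then have "cinner g' f = cinner g (adj_map A f)"
    using g' by (simp add: adj_op_iff)
  then have "cinner f g' = cinner (adj_map A f) g"
    by (metis cinner_commute)
  then show "B f g = cinner (adj_map A f) g"
    using B_adj_T[of g g' f] g' A_subset_adj_T f by auto
qed

lemma k_base: "f \<in> Domain A \<Longrightarrow> k f = 0"
proof -
  assume f: "f \<in> Domain A"
  obtain f' where f': "(f, f') \<in> A"
    using f by blast
  then have "(f, f') \<in> T" "(f, f') \<in> adj_op T" "f \<in> plus_space A"
    using A_subset_T A_subset_adj_T A_D by blast+
  then have "B f f = cinner f' f" "B f f = cinner f f'"
    using B_on_T B_adj_T by blast+
  then have "B f f = cnj (B f f)"
    by (metis cinner_commute)
  then show "k f = 0"
    using imaginary_part[of f f] \<open>f \<in> plus_space A\<close> by simp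
qed

text \<open>The state operator takes values in the Hilbert space only on the domain of \<open>T\<close>. Indeed, let
  \<open>B f = h\<close>, and let \<open>t\<close> solve \<open>(T - z) t = h - z f\<close>. Then \<open>B - z\<close> annihilates \<open>f - t\<close>, and
  pairing with the domain of \<open>T\<^sup>*\<close>, on which \<open>T\<^sup>* - cnj z\<close> is surjective, gives \<open>f = t\<close>.\<close>

lemma T_maximal:
  assumes f: "f \<in> plus_space A" and h: "\<And>g. g \<in> plus_space A \<Longrightarrow> B f g = cinner h g"
  shows "(f, h) \<in> T"
proof -
  obtain z where z: "z \<in> resolvent_set T"
    using resolvent_nonempty by blast
  then obtain t where t: "(t, (h - z *\<^sub>C f) + z *\<^sub>C t) \<in> T"
    unfolding resolvent_set_def by blast
  have tp: "t \<in> plus_space A"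
    using T_D[OF t] by simp
  define d where "d = f - t"
  obtain g where g: "(g, d + cnj z *\<^sub>C g) \<in> adj_op T"
    using resolvent_adjoint_surj[OF linear_T z] by blast
  have gp: "g \<in> plus_space A"
    using adj_T_D[OF g] by simp
  have "B d g = cinner d (d + cnj z *\<^sub>C g)"
    using B_adj_T[OF g] f tp by (simp add: d_def plus_space_diff)
  moreover have "B d g = cinner (z *\<^sub>C d) g"
    using f tp B_on_T[OF t gp] h[OF gp]
    by (simp add: d_def B_diff_left cinner_algebra complex_vector.scale_right_diff_distrib)
  ultimately have "cinner d d = 0"
    by (simp add: cinner_algebra)
  then have "f = t"
    by (simp add: d_def)
  then show ?thesis
    using t by simp
qed

text \<open>On the kernel of \<open>K\<^sup>*\<close> the state operator is formally symmetric. So an element of this kernel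
  that belongs to the domain of \<open>T\<close> or of \<open>T\<^sup>*\<close> belongs to both, hence to the domain of \<open>A\<close>; this
  is where \<open>Dom A = Dom T \<inter> Dom T\<^sup>*\<close> enters.\<close>

lemma base_if_T_k0:
  assumes "(f, f') \<in> T" "k f = 0"
  shows "f \<in> Domain A"
proof -
  have f: "f \<in> plus_space A"
    using T_D[OF assms(1)] by simp
  have "cinner t' f = cinner t f'" if t: "(t, t') \<in> T" for t t'
  proof -
    have tp: "t \<in> plus_space A"
      using T_D[OF t] by simp
    have "B t f = cnj (B f t)"
      using imaginary_part[OF tp f] assms(2) by simp
    then show ?thesis
      using B_on_T[OF t f] B_on_T[OF assms(1) tp] by (metis cinner_commute)
  qed
  then have "(f, f') \<in> adj_op T"
    by (simp add: adj_op_iff)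
  then show ?thesis
    using assms(1) Domain_A by blast
qed

lemma base_if_adj_T_k0:
  assumes "(f, f') \<in> adj_op T" "k f = 0"
  shows "f \<in> Domain A"
proof -
  have f: "f \<in> plus_space A"
    using adj_T_D[OF assms(1)] by simp
  have "B f g = cinner f' g" if g: "g \<in> plus_space A" for g
  proof -
    have "B f g = cnj (B g f)"
      using imaginary_part[OF f g] assms(2) by simp
    then show ?thesis
      using B_adj_T[OF assms(1) g] by (metis cinner_commute)
  qed
  then have "(f, f') \<in> T"
    using T_maximal f by blast
  then show ?thesis
    using assms Domain_A by blast
qed

text \<open>Write \<open>w\<close> in \<open>ker (A\<^sup>* - z)\<close> as \<open>(T\<^sup>* - cnj z) s\<close>. If \<open>k s = 0\<close>, then \<open>s\<close> lies in the domain of \<open>A\<close>,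
  so \<open>w\<close> is in the range of \<open>A - cnj z\<close>, which is orthogonal to \<open>ker (A\<^sup>* - z)\<close>; hence \<open>w = 0\<close>. Thus
  the number \<open>k s\<close> determines \<open>w\<close>.\<close>

lemma deficiency_space_one_dimensional:
  assumes z: "z \<in> resolvent_set T"
    and x: "x \<in> plus_space A" "adj_map A x = z *\<^sub>C x"
    and y: "y \<in> plus_space A" "adj_map A y = z *\<^sub>C y" "y \<noteq> 0"
  shows "\<exists>c. x = c *\<^sub>C y"
proof -
  have orth: "cinner u w = 0"
    if "(s, u + cnj z *\<^sub>C s) \<in> adj_op T" "k s = 0" "w \<in> plus_space A" "adj_map A w = z *\<^sub>C w"
    for s u w
  proof -
    have "B w s = cinner (adj_map A w) s"
      using B_on_base[OF base_if_adj_T_k0[OF that(1,2)] that(3)] .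
    moreover have "B w s = cinner w (u + cnj z *\<^sub>C s)"
      using B_adj_T[OF that(1,3)] .
    ultimately have "cinner w u = 0"
      by (simp add: that(4) cinner_algebra)
    then show ?thesis
      using cinner_commute[of u w] by simp
  qed
  obtain p where p: "(p, x + cnj z *\<^sub>C p) \<in> adj_op T"
    using resolvent_adjoint_surj[OF linear_T z] by blast
  obtain q where q: "(q, y + cnj z *\<^sub>C q) \<in> adj_op T"
    using resolvent_adjoint_surj[OF linear_T z] by blast
  have pq: "p \<in> plus_space A" "q \<in> plus_space A"
    using adj_T_D[OF p] adj_T_D[OF q] by simp_all
  have kq: "k q \<noteq> 0"
    using orth[OF q _ y(1,2)] y(3) by auto
  define c where "c = - (k p / k q)"
  define w where "w = x + c *\<^sub>C y"
  have "(p + c *\<^sub>C q, w + cnj z *\<^sub>C (p + c *\<^sub>C q)) \<in> adj_op T"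
    using adj_op_add[OF p adj_op_scaleC[OF q, of c]]
    by (simp add: w_def scaleC_add_right scaleC_scaleC algebra_simps)
  moreover have "k (p + c *\<^sub>C q) = k p + c * k q"
    using pq by (simp add: k_add k_scaleC plus_space_scaleC)
  then have "k (p + c *\<^sub>C q) = 0"
    using kq by (simp add: c_def)
  moreover have "w \<in> plus_space A" "adj_map A w = z *\<^sub>C w"
    using x y by (simp_all add: w_def plus_space_add plus_space_scaleC adj_map_add[OF dense]
        adj_map_scaleC[OF dense] scaleC_add_right scaleC_scaleC mult.commute)
  ultimately have "cinner w w = 0"
    using orth by blast
  then have "x = (- c) *\<^sub>C y"
    by (simp add: w_def add_eq_0_iff2 complex_vector.scale_minus_left)
  then show ?thesis
    by blast
qed

text \<open>The quasi-kernel of the real part must contain an element outside the kernel of \<open>K\<^sup>*\<close>. Otherwise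
  it would be contained in \<open>A\<close>; being self-adjoint, it would then contain \<open>A\<^sup>*\<close>, so \<open>T\<close> would be
  a restriction of \<open>A\<close> and therefore symmetric.\<close>

lemma quasi_kernel_element:
  obtains f0 where "f0 \<in> plus_space A" "k f0 \<noteq> 0"
    "\<And>g. g \<in> plus_space A \<Longrightarrow> B f0 g = cinner (adj_map A f0) g + \<i> * k f0 * cnj (k g)"
proof -
  let ?Q = "quasi_kernel A (pm_Re A B)"
  have Q: "f \<in> plus_space A" "h = adj_map A f"
    "g \<in> plus_space A \<Longrightarrow> B f g = cinner (adj_map A f) g + \<i> * k f * cnj (k g)"
    if fh: "(f, h) \<in> ?Q" for f h g
  proof -
    show f: "f \<in> plus_space A"
      using fh by (simp add: quasi_kernel_def)
    have Bfg: "B f g = cinner h g + \<i> * k f * cnj (k g)" if g: "g \<in> plus_space A" for g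
    proof -
      have "pm_Re A B f = embed A h"
        using fh by (simp add: quasi_kernel_def)
      from fun_cong[OF this, of g] have "B f g + cnj (B g f) = 2 * cinner h g"
        using f g by (simp add: pm_Re_def pm_adj_def embed_def)
      then have "2 * B f g = 2 * (cinner h g + \<i> * k f * cnj (k g))"
        using imaginary_part[OF f g] by (simp add: algebra_simps)
      then show ?thesis
        by (subst (asm) mult_cancel_left) simp
    qed
    have "cinner g (h - adj_map A f) = 0" if g: "g \<in> Domain A" for g
    proof -
      have "g \<in> plus_space A"
        using g A_D by blast
      then have "cinner h g = cinner (adj_map A f) g"
        using Bfg B_on_base[OF g f] k_base[OF g] by simp
      then show ?thesis
        by (metis cinner_commute cinner_diff_right eq_iff_diff_eq_0)
    qed
    then have "h - adj_map A f = 0"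
      by (rule densely_defined_orthogonal_zero[OF dense])
    then show h: "h = adj_map A f"
      by simp
    show "B f g = cinner (adj_map A f) g + \<i> * k f * cnj (k g)" if "g \<in> plus_space A"
      using Bfg[OF that] h by simp
  qed
  have "\<exists>f h. (f, h) \<in> ?Q \<and> k f \<noteq> 0"
  proof (rule ccontr)
    assume "\<nexists>f h. (f, h) \<in> ?Q \<and> k f \<noteq> 0"
    then have k0: "k f = 0" if "(f, h) \<in> ?Q" for f h
      using that by blast
    have "?Q \<subseteq> A"
    proof (rule subrelI)
      fix f h assume fh: "(f, h) \<in> ?Q"
      then have "(f, h) \<in> T"
        using Q[OF fh] k0[OF fh] by (intro T_maximal) auto
      then obtain f' where "(f, f') \<in> A"
        using base_if_T_k0 k0[OF fh] by blast
      then show "(f, h) \<in> A"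
        using A_D Q(2)[OF fh] by blast
    qed
    then have "adj_op A \<subseteq> adj_op ?Q"
      by (rule adj_op_antimono)
    also have "\<dots> = ?Q"
      using self_adjoint_quasi_kernel by (simp add: self_adjoint_in_def)
    finally have "T \<subseteq> adj_op T"
      using T_subset_adj_A \<open>?Q \<subseteq> A\<close> A_subset_adj_T by blast
    then show False
      using not_symmetric_T by (simp add: symmetric_operator_def)
  qed
  then obtain f h where fh: "(f, h) \<in> ?Q" and "k f \<noteq> 0"
    by blast
  then show thesis
    using that[of f] Q[OF fh] by blast
qed

text \<open>If \<open>K\<^sup>*\<close> vanished on the domain of \<open>T\<close>, then \<open>T\<close> would coincide with the symmetric operator
  \<open>A\<close>.\<close>

lemma k_nonzero_on_main:
  obtains t where "t \<in> Domain T" "k t \<noteq> 0"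
proof -
  have "\<exists>t\<in>Domain T. k t \<noteq> 0"
  proof (rule ccontr)
    assume "\<not> (\<exists>t\<in>Domain T. k t \<noteq> 0)"
    then have "Domain T \<subseteq> Domain A"
      using base_if_T_k0 by blast
    have "T \<subseteq> A"
    proof (rule subrelI)
      fix f h assume fh: "(f, h) \<in> T"
      then obtain f' where "(f, f') \<in> A"
        using \<open>Domain T \<subseteq> Domain A\<close> by blast
      then show "(f, h) \<in> A"
        using A_D T_D[OF fh] by blast
    qed
    then show False
      using A_subset_adj_T not_symmetric_T by (auto simp: symmetric_operator_def)
  qed
  then show thesis
    using that by blast
qed

lemma plus_space_decomposition:
  assumes z: "z \<in> resolvent_set T" and f: "f \<in> plus_space A"
  obtains t x where "(t, adj_map A t) \<in> T" "x \<in> plus_space A" "adj_map A x = z *\<^sub>C x" "f = t + x"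
proof -
  obtain t where t: "(t, (adj_map A f - z *\<^sub>C f) + z *\<^sub>C t) \<in> T"
    using z unfolding resolvent_set_def by blast
  have tp: "t \<in> plus_space A" "(adj_map A f - z *\<^sub>C f) + z *\<^sub>C t = adj_map A t"
    using T_D[OF t] by simp_all
  show thesis
  proof (rule that[of t "f - t"])
    show "adj_map A (f - t) = z *\<^sub>C (f - t)"
      using f tp(1) by (simp add: adj_map_diff[OF dense] complex_vector.scale_right_diff_distrib
          tp(2)[symmetric])
  qed (use t tp f plus_space_diff in auto)
qed

text \<open>The positive space is spanned by the domain of \<open>T\<close>, where \<open>B = A\<^sup>*\<close>, and by the single vector
  \<open>f0\<close> of the quasi-kernel of the real part, where \<open>B f0 = A\<^sup>* f0 + \<i> (k f0) \<chi>\<close>. So \<open>B - A\<^sup>*\<close> takes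
  values in the multiples of \<open>\<chi>\<close>, and pairing with \<open>f0\<close> computes the coefficient \<open>m\<close>.\<close>

lemma state_op_rank_one_perturbation:
  obtains m where
    "\<And>f g. \<lbrakk>f \<in> plus_space A; g \<in> plus_space A\<rbrakk> \<Longrightarrow> B f g = cinner (adj_map A f) g + m f * cnj (k g)"
    "\<And>f g. \<lbrakk>f \<in> plus_space A; g \<in> plus_space A\<rbrakk> \<Longrightarrow> m (f + g) = m f + m g"
    "\<And>c f. f \<in> plus_space A \<Longrightarrow> m (c *\<^sub>C f) = c * m f"
    "\<exists>C. \<forall>f\<in>plus_space A. cmod (m f) \<le> C * plus_norm A f"
    "\<exists>f0\<in>plus_space A. k f0 \<noteq> 0 \<and> m f0 = \<i> * k f0"
proof -
  obtain f0 where f0: "f0 \<in> plus_space A" "k f0 \<noteq> 0"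
    "\<And>g. g \<in> plus_space A \<Longrightarrow> B f0 g = cinner (adj_map A f0) g + \<i> * k f0 * cnj (k g)"
    using quasi_kernel_element by blast
  obtain z where z: "z \<in> resolvent_set T"
    using resolvent_nonempty by blast
  obtain t0 x0 where t0: "(t0, adj_map A t0) \<in> T" and x0: "x0 \<in> plus_space A"
    "adj_map A x0 = z *\<^sub>C x0" "f0 = t0 + x0"
    using plus_space_decomposition[OF z f0(1)] .
  have t0p: "t0 \<in> plus_space A"
    using T_D[OF t0] by simp
  have "x0 \<noteq> 0"
  proof
    assume "x0 = 0"
    then have "B f0 f0 = cinner (adj_map A f0) f0"
      using B_on_T[OF t0 f0(1)] x0(3) by simp
    then show False
      using f0 by simp
  qed
  \<comment> \<open>The division undoes the factor \<open>(\<chi>, f0)\<close> that the pairing of \<open>\<chi>\<close> with \<open>f0\<close> produces.\<close>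
  define m where "m f = (B f f0 - cinner (adj_map A f) f0) / cnj (k f0)" for f
  have Bm: "B f g = cinner (adj_map A f) g + m f * cnj (k g)"
    if f: "f \<in> plus_space A" and g: "g \<in> plus_space A" for f g
  proof -
    obtain t x where t: "(t, adj_map A t) \<in> T" and x: "x \<in> plus_space A"
      "adj_map A x = z *\<^sub>C x" "f = t + x"
      using plus_space_decomposition[OF z f] .
    have tp: "t \<in> plus_space A"
      using T_D[OF t] by simp
    obtain c where c: "x = c *\<^sub>C x0"
      using deficiency_space_one_dimensional[OF z x(1,2) x0(1,2) \<open>x0 \<noteq> 0\<close>] by blast
    have rank: "B f g = cinner (adj_map A f) g + c * (\<i> * k f0) * cnj (k g)"
      if g: "g \<in> plus_space A" for g
    proof -
      have "B x0 g = cinner (adj_map A x0) g + \<i> * k f0 * cnj (k g)"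
        using f0(3)[OF g] B_on_T[OF t0 g] x0(1) t0p
        by (simp add: x0(3) B_add_left adj_map_add[OF dense] cinner_algebra)
      then show ?thesis
        using B_on_T[OF t g] x0(1) tp
        by (simp add: x(3) c B_add_left B_scaleC_left adj_map_add[OF dense] plus_space_scaleC
            adj_map_scaleC[OF dense] cinner_algebra algebra_simps)
    qed
    have "m f = c * (\<i> * k f0)"
      using rank[OF f0(1)] f0(2) by (simp add: m_def)
    then show ?thesis
      using rank[OF g] by simp
  qed
  have m_bounded: "\<exists>C. \<forall>f\<in>plus_space A. cmod (m f) \<le> C * plus_norm A f"
  proof -
    \<comment> \<open>\<open>B f f0\<close> is continuous in \<open>f\<close> because it differs from the conjugate of \<open>B f0 f\<close>, and \<open>B f0\<close> is in
        the negative space, by a multiple of \<open>k f\<close>.\<close>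
    have "B f0 \<in> minus_space A"
      using bounded_B f0(1) by (simp add: bounded_plus_minus_def)
    then obtain C where C: "\<And>f. f \<in> plus_space A \<Longrightarrow> cmod (B f0 f) \<le> C * plus_norm A f"
      unfolding minus_space_def by blast
    obtain D where D: "\<And>f. f \<in> plus_space A \<Longrightarrow> cmod (k f) \<le> D * plus_norm A f"
      using k_bounded by blast
    define E where "E = (C + 2 * cmod (k f0) * D + norm f0) / cmod (k f0)"
    have "cmod (m f) \<le> E * plus_norm A f" if f: "f \<in> plus_space A" for f
    proof -
      have "B f f0 = cnj (B f0 f) + 2 * \<i> * (k f * cnj (k f0))"
        using imaginary_part[OF f f0(1)] by (simp add: algebra_simps)
      then have "cmod (B f f0) \<le> cmod (B f0 f) + 2 * cmod (k f) * cmod (k f0)"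
        using norm_triangle_ineq[of "cnj (B f0 f)" "2 * \<i> * (k f * cnj (k f0))"]
        by (simp add: norm_mult)
      also have "\<dots> \<le> C * plus_norm A f + 2 * (D * plus_norm A f) * cmod (k f0)"
        using C[OF f] D[OF f] by (intro add_mono mult_right_mono) auto
      finally have "cmod (B f f0) \<le> C * plus_norm A f + 2 * (D * plus_norm A f) * cmod (k f0)" .
      moreover have "cmod (cinner (adj_map A f) f0) \<le> plus_norm A f * norm f0"
        using cauchy_schwarz[of "adj_map A f" f0]
          mult_right_mono[OF norm_adj_map_le_plus_norm norm_ge_zero, of A f f0] by linarith
      moreover have "cmod (B f f0 - cinner (adj_map A f) f0) \<le>
          cmod (B f f0) + cmod (cinner (adj_map A f) f0)"
        by (rule norm_triangle_ineq4)
      ultimately have "cmod (B f f0 - cinner (adj_map A f) f0) \<le>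
          (C + 2 * cmod (k f0) * D + norm f0) * plus_norm A f"
        by (simp add: algebra_simps)
      then show ?thesis
        using f0(2) by (simp add: m_def E_def norm_divide divide_right_mono)
    qed
    then show ?thesis
      by blast
  qed
  show thesis
  proof (rule that[of m])
    show "\<exists>f0\<in>plus_space A. k f0 \<noteq> 0 \<and> m f0 = \<i> * k f0"
      using f0 by (auto simp: m_def intro!: bexI[of _ f0])
    show "m (f + g) = m f + m g" if "f \<in> plus_space A" "g \<in> plus_space A" for f g
      using that by (simp add: m_def B_add_left adj_map_add[OF dense] cinner_algebra
          add_divide_distrib diff_divide_distrib)
    show "m (c *\<^sub>C f) = c * m f" if "f \<in> plus_space A" for c f
      using that by (simp add: m_def B_scaleC_left adj_map_scaleC[OF dense] cinner_algebra
          right_diff_distrib)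
  qed (use Bm m_bounded in blast)+
qed

text \<open>The normal form forces \<open>\<Gamma>\<^sub>1 = m - \<i> \<Gamma>\<^sub>0\<close>. Green's identity expresses that the imaginary part of
  the state operator is \<open>K K\<^sup>*\<close>. The pair is surjective since \<open>\<Gamma>\<^sub>1\<close> vanishes at \<open>f0\<close> but
  \<open>\<Gamma>\<^sub>0\<close> does not, whereas \<open>\<Gamma>\<^sub>1 = - \<i> \<Gamma>\<^sub>0 \<noteq> 0\<close> at some point of the domain of \<open>T\<close>.\<close>

theorem realized_by_boundary_triple:
  obtains \<Gamma>\<^sub>0 \<Gamma>\<^sub>1 where "boundary_triple A \<Gamma>\<^sub>0 \<Gamma>\<^sub>1" "boundary_triple.realizes A \<Gamma>\<^sub>0 \<Gamma>\<^sub>1 \<Theta>"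
proof -
  obtain m where Bm: "\<And>f g. \<lbrakk>f \<in> plus_space A; g \<in> plus_space A\<rbrakk> \<Longrightarrow>
      B f g = cinner (adj_map A f) g + m f * cnj (k g)"
    and m_add: "\<And>f g. \<lbrakk>f \<in> plus_space A; g \<in> plus_space A\<rbrakk> \<Longrightarrow> m (f + g) = m f + m g"
    and m_scaleC: "\<And>c f. f \<in> plus_space A \<Longrightarrow> m (c *\<^sub>C f) = c * m f"
    and m_bounded: "\<exists>C. \<forall>f\<in>plus_space A. cmod (m f) \<le> C * plus_norm A f"
    and "\<exists>f0\<in>plus_space A. k f0 \<noteq> 0 \<and> m f0 = \<i> * k f0"
    using state_op_rank_one_perturbation by blast
  then obtain f0 where f0: "f0 \<in> plus_space A" "k f0 \<noteq> 0" "m f0 = \<i> * k f0"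
    by blast
  have T_iff: "(f, h) \<in> T \<longleftrightarrow> f \<in> plus_space A \<and> h = adj_map A f \<and> m f = 0" for f h
  proof
    assume fh: "(f, h) \<in> T"
    then have f: "f \<in> plus_space A" "h = adj_map A f"
      using T_D by blast+
    have "m f * cnj (k f0) = 0"
      using B_on_T[OF fh f0(1)] Bm[OF f(1) f0(1)] f(2) by simp
    then show "f \<in> plus_space A \<and> h = adj_map A f \<and> m f = 0"
      using f f0(2) by simp
  qed (auto intro!: T_maximal simp: Bm)
  obtain t where t: "t \<in> Domain T" "k t \<noteq> 0"
    using k_nonzero_on_main .
  then have tp: "t \<in> plus_space A" "m t = 0"
    using T_iff by blast+
  define \<Gamma>\<^sub>1 where "\<Gamma>\<^sub>1 f = m f - \<i> * k f" for f
  have triple: "boundary_triple A k \<Gamma>\<^sub>1"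
  proof
    show "base_operator A"
      using system by (simp add: L_system_def)
    show "\<exists>C. \<forall>f\<in>plus_space A. cmod (k f) \<le> C * plus_norm A f"
      by (rule k_bounded)
    show "\<exists>C. \<forall>f\<in>plus_space A. cmod (\<Gamma>\<^sub>1 f) \<le> C * plus_norm A f"
    proof -
      obtain C where C: "\<And>f. f \<in> plus_space A \<Longrightarrow> cmod (m f) \<le> C * plus_norm A f"
        using m_bounded by blast
      obtain D where D: "\<And>f. f \<in> plus_space A \<Longrightarrow> cmod (k f) \<le> D * plus_norm A f"
        using k_bounded by blast
      have "cmod (\<Gamma>\<^sub>1 f) \<le> (C + D) * plus_norm A f" if f: "f \<in> plus_space A" for f
        using norm_triangle_ineq4[of "m f" "\<i> * k f"] C[OF f] D[OF f]
        by (simp add: \<Gamma>\<^sub>1_def norm_mult algebra_simps)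
      then show ?thesis
        by blast
    qed
    show "cinner (adj_map A f) g - cinner f (adj_map A g) = k f * cnj (\<Gamma>\<^sub>1 g) - \<Gamma>\<^sub>1 f * cnj (k g)"
      if "f \<in> plus_space A" "g \<in> plus_space A" for f g
    proof -
      have "cnj (cinner (adj_map A g) f) = cinner f (adj_map A g)"
        by (metis cinner_commute)
      then have "cinner (adj_map A f) g + m f * cnj (k g) -
          (cinner f (adj_map A g) + cnj (m g) * k f) = 2 * \<i> * (k f * cnj (k g))"
        using imaginary_part[OF that] by (simp add: Bm that)
      then have "cinner (adj_map A f) g - cinner f (adj_map A g) =
          2 * \<i> * (k f * cnj (k g)) - m f * cnj (k g) + cnj (m g) * k f"
        by (simp add: algebra_simps)
      then show ?thesis
        by (simp add: \<Gamma>\<^sub>1_def algebra_simps)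
    qed
    show "\<exists>f\<in>plus_space A. k f = u \<and> \<Gamma>\<^sub>1 f = v" for u v
    proof
      define p q where "p = (u - \<i> * v) / k f0" and "q = \<i> * v / k t"
      let ?f = "p *\<^sub>C f0 + q *\<^sub>C t"
      show "?f \<in> plus_space A"
        using f0 tp by (simp add: plus_space_add plus_space_scaleC)
      have kf: "k ?f = p * k f0 + q * k t" and mf: "m ?f = p * m f0 + q * m t"
        using f0 tp by (simp_all add: plus_space_scaleC k_add k_scaleC m_add m_scaleC)
      have pk: "p * k f0 = u - \<i> * v" and qk: "q * k t = \<i> * v"
        using f0 t by (simp_all add: p_def q_def)
      have "k ?f = u"
        unfolding kf pk qk by simp
      moreover have "m ?f = \<i> * (p * k f0)"
        using f0 tp by (simp add: mf)
      then have "m ?f = \<i> * u + v"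
        unfolding pk by (simp add: right_diff_distrib)
      ultimately show "k ?f = u \<and> \<Gamma>\<^sub>1 ?f = v"
        by (simp add: \<Gamma>\<^sub>1_def)
    qed
  qed (simp_all add: \<Gamma>\<^sub>1_def k_add k_scaleC m_add m_scaleC algebra_simps)
  interpret boundary_triple A k \<Gamma>\<^sub>1
    by (rule triple)
  have "T = main_op"
    by (auto simp: T_iff main_op_iff \<Gamma>\<^sub>1_def)
  moreover have "B f = triple_state_op f" if f: "f \<in> plus_space A" for f
    using f by (auto simp: triple_state_op_def Bm B_outside \<Gamma>\<^sub>1_def)
  moreover have "channel \<Theta> = triple_channel"
    by (auto simp: triple_channel_def fun_eq_iff channel_outside) (simp add: channel_eq)
  ultimately have "realizes \<Theta>"
    by (simp add: realizes_def)
  then show thesis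
    using that triple by blast
qed

end

text \<open>Rotated and original boundary triple have the same main operator, so one vector of
  \<open>ker (A\<^sup>* - z)\<close> computes both transfer functions.\<close>

theorem unimodular_transformation_exists:
  assumes "L_system \<Theta>"
  obtains \<Theta>\<^sub>\<alpha> where "L_system \<Theta>\<^sub>\<alpha>" "main \<Theta>\<^sub>\<alpha> = main \<Theta>"
    "\<And>z e. z \<in> L_domain \<Theta> \<Longrightarrow>
      L_transfer \<Theta>\<^sub>\<alpha> z e = L_transfer \<Theta> z e * (- exp (2 * \<i> * complex_of_real \<alpha>))"
proof -
  interpret l_system \<Theta>
    by (rule l_system.intro[OF assms])
  obtain \<Gamma>\<^sub>0 \<Gamma>\<^sub>1 where "boundary_triple (sym \<Theta>) \<Gamma>\<^sub>0 \<Gamma>\<^sub>1"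
    and "boundary_triple.realizes (sym \<Theta>) \<Gamma>\<^sub>0 \<Gamma>\<^sub>1 \<Theta>"
    using realized_by_boundary_triple .
  interpret b: boundary_triple "sym \<Theta>" \<Gamma>\<^sub>0 \<Gamma>\<^sub>1
    by fact
  have real: "b.realizes \<Theta>"
    by fact
  define G0 where "G0 f = sin \<alpha> * \<Gamma>\<^sub>0 f + cos \<alpha> * \<Gamma>\<^sub>1 f" for f
  define G1 where "G1 f = sin \<alpha> * \<Gamma>\<^sub>1 f - cos \<alpha> * \<Gamma>\<^sub>0 f" for f
  interpret r: boundary_triple "sym \<Theta>" G0 G1
    unfolding G0_def G1_def by (rule b.rotated_boundary_triple) simp
  have plus: "G1 f + \<i> * G0 f = \<i> * exp (- (\<i> * \<alpha>)) * (\<Gamma>\<^sub>1 f + \<i> * \<Gamma>\<^sub>0 f)"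
    and minus: "G1 f - \<i> * G0 f = - \<i> * exp (\<i> * \<alpha>) * (\<Gamma>\<^sub>1 f - \<i> * \<Gamma>\<^sub>0 f)" for f
    unfolding G0_def G1_def by (rule rotated_combinations)+
  have main: "r.main_op = b.main_op" "b.main_op = main \<Theta>"
    using real by (auto simp: r.main_op_def b.main_op_def plus b.realizes_def)
  have "L_system r.triple_system"
    by (rule r.L_system_triple_system) (use assms main in \<open>simp add: L_system_def\<close>)
  moreover have "main r.triple_system = main \<Theta>"
    by (simp add: r.triple_system_def main)
  moreover have "L_transfer r.triple_system z e = L_transfer \<Theta> z e * (- exp (2 * \<i> * \<alpha>))"
    if "z \<in> L_domain \<Theta>" for z e
  proof -
    have z: "z \<in> resolvent_set b.main_op" "z \<in> resolvent_set r.main_op"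
      using that by (simp_all add: L_domain_def main)
    obtain x where x: "x \<in> plus_space A" "adj_map A x = z *\<^sub>C x" "\<Gamma>\<^sub>1 x + \<i> * \<Gamma>\<^sub>0 x = 1"
      using b.deficiency_element[OF z(1)] .
    have exp2: "exp (\<i> * \<alpha>) / exp (- (\<i> * \<alpha>)) = exp (2 * \<i> * \<alpha>)"
      by (simp add: exp_diff[symmetric] mult.assoc)
    have "L_transfer r.triple_system z e = e * ((G1 x - \<i> * G0 x) / (G1 x + \<i> * G0 x))"
      by (rule r.realized_transfer[OF r.realizes_triple_system z(2) x(1,2)]) (simp add: plus x)
    also have "\<dots> = e * (\<Gamma>\<^sub>1 x - \<i> * \<Gamma>\<^sub>0 x) * (- (exp (\<i> * \<alpha>) / exp (- (\<i> * \<alpha>))))"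
      by (simp add: plus minus x(3) field_simps)
    also have "e * (\<Gamma>\<^sub>1 x - \<i> * \<Gamma>\<^sub>0 x) = L_transfer \<Theta> z e"
      using b.realized_transfer[OF real z(1) x(1,2), of e] x(3) by simp
    finally show ?thesis
      unfolding exp2 .
  qed
  ultimately show thesis
    using that by blast
qed


section \<open>Couplings with a controller\<close>

lemma L_system_solution_eqI:
  assumes "L_system \<Theta>" "z \<in> L_domain \<Theta>"
    and "x \<in> plus_space (sym \<Theta>)"
    and "(\<lambda>g. state_op \<Theta> x g - z * embed (sym \<Theta>) x g) = channel \<Theta> e"
  shows "L_solution \<Theta> z (channel \<Theta> e) = x"
proof -
  interpret l_system \<Theta>
    by (rule l_system.intro[OF assms(1)])
  obtain \<Gamma>\<^sub>0 \<Gamma>\<^sub>1 where "boundary_triple (sym \<Theta>) \<Gamma>\<^sub>0 \<Gamma>\<^sub>1"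
    and real: "boundary_triple.realizes (sym \<Theta>) \<Gamma>\<^sub>0 \<Gamma>\<^sub>1 \<Theta>"
    using realized_by_boundary_triple .
  then interpret b: boundary_triple "sym \<Theta>" \<Gamma>\<^sub>0 \<Gamma>\<^sub>1
    by simp
  have z: "z \<in> resolvent_set b.main_op"
    using assms(2) real by (simp add: L_domain_def b.realizes_def)
  obtain x0 where "x0 \<in> plus_space A" "adj_map A x0 = z *\<^sub>C x0" "\<Gamma>\<^sub>1 x0 + \<i> * \<Gamma>\<^sub>0 x0 = 1"
    using b.deficiency_element[OF z] .
  note iff = b.realized_solution_iff[OF real z this, of _ e]
  have "x = e *\<^sub>C x0"
    using iff[of x] assms(3,4) by blast
  then show ?thesis
    unfolding L_solution_def iff by simp
qed

lemma L_transfer_mult: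
  assumes "L_system \<Theta>" "z \<in> L_domain \<Theta>"
  shows "L_transfer \<Theta> z (e * u) = L_transfer \<Theta> z e * u"
proof -
  interpret l_system \<Theta>
    by (rule l_system.intro[OF assms(1)])
  obtain \<Gamma>\<^sub>0 \<Gamma>\<^sub>1 where "boundary_triple (sym \<Theta>) \<Gamma>\<^sub>0 \<Gamma>\<^sub>1"
    and real: "boundary_triple.realizes (sym \<Theta>) \<Gamma>\<^sub>0 \<Gamma>\<^sub>1 \<Theta>"
    using realized_by_boundary_triple .
  then interpret b: boundary_triple "sym \<Theta>" \<Gamma>\<^sub>0 \<Gamma>\<^sub>1
    by simp
  have z: "z \<in> resolvent_set b.main_op"
    using assms(2) real by (simp add: L_domain_def b.realizes_def)
  obtain x where x: "x \<in> plus_space A" "adj_map A x = z *\<^sub>C x" "\<Gamma>\<^sub>1 x + \<i> * \<Gamma>\<^sub>0 x = 1"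
    using b.deficiency_element[OF z] .
  show ?thesis
    using b.realized_transfer[OF real z x(1,2)] x(3) by simp
qed

lemma cadjoint_from_complex:
  assumes "bounded_clinear (K :: complex \<Rightarrow> 'h::complex_hilbert)"
  shows "cadjoint K = (\<lambda>y. cinner y (K 1))"
proof (rule cadjoint_eqI)
  fix e y
  have "K (e *\<^sub>C 1) = e *\<^sub>C K 1"
    using assms unfolding bounded_clinear_def by blast
  then have "K e = e *\<^sub>C K 1"
    by (simp add: scaleC_complex_def)
  then have "cinner (K e) y = e * cinner (K 1) y"
    by (simp add: cinner_scaleC_left)
  then show "cinner (K e) y = cinner e (cinner y (K 1))"
    using cinner_commute[of "K 1" y] by (simp add: cinner_complex_def)
qed

text \<open>The second row of the equation of the coupling involves \<open>y\<close> only; it makes the argument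
  \<open>e - 2 \<i> K\<^sub>2\<^sup>* y\<close> of the L-system the output of the F-system for the input \<open>e\<close>.
  Some \<open>y\<close> is used instead of the transfer function of the F-system because membership of \<open>z\<close> in
  the domain of the coupling does not make \<open>M - z F\<close> invertible.\<close>

lemma LF_transfer_factorizes:
  fixes \<Phi> :: "'h::complex_hilbert F_array"
  assumes sys: "L_system \<Theta>" and F: "F_system \<Phi>"
    and z: "z \<in> L_domain \<Theta>" "z \<in> LF_domain (LF_coupling \<Theta> \<Phi>)"
  obtains y where "F_M \<Phi> y - z *\<^sub>C F_F \<Phi> y = F_K \<Phi> e"
    "LF_transfer (LF_coupling \<Theta> \<Phi>) z e = L_transfer \<Theta> z (e - 2 * \<i> * cadjoint (F_K \<Phi>) y)"
proof -
  let ?\<Omega> = "LF_coupling \<Theta> \<Phi>"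
  have "\<exists>!p. LF_is_solution ?\<Omega> z e p"
    using z(2) by (simp add: LF_domain_def)
  then obtain x y where sol: "LF_is_solution ?\<Omega> z e (x, y)"
    and the: "(THE p. LF_is_solution ?\<Omega> z e p) = (x, y)"
    by (metis surj_pair the1_equality)
  have K: "cadjoint (F_K \<Phi>) = (\<lambda>y. cinner y (F_K \<Phi> 1))"
    using F by (intro cadjoint_from_complex) (simp add: F_system_def)
  define e' where "e' = e - 2 * \<i> * cadjoint (F_K \<Phi>) y"
  have y: "F_M \<Phi> y - z *\<^sub>C F_F \<Phi> y = F_K \<Phi> e" and x: "x \<in> plus_space (sym \<Theta>)"
    and eq: "(\<lambda>g. state_op \<Theta> x g + 2 * \<i> * channel \<Theta> (cadjoint (F_K \<Phi>) y) g
      - z * embed (sym \<Theta>) x g) = channel \<Theta> e"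
    using sol by (auto simp: LF_is_solution_def LF_plus_def LF_pencil_def LF_coupling_def)
  have ch: "channel \<Theta> c g = c * channel \<Theta> 1 g" for c g
  proof -
    have "bounded_complex_minus (sym \<Theta>) (channel \<Theta>)"
      using sys by (simp add: L_system_def)
    then have "channel \<Theta> (c * 1) = (\<lambda>g. c * channel \<Theta> 1 g)"
      unfolding bounded_complex_minus_def by blast
    then show ?thesis
      by simp
  qed
  have "state_op \<Theta> x g - z * embed (sym \<Theta>) x g = channel \<Theta> e' g" for g
    using fun_cong[OF eq, of g]
    unfolding ch[of "cadjoint (F_K \<Phi>) y" g] ch[of e g] ch[of e' g]
    by (simp add: e'_def algebra_simps)
  then have "L_solution \<Theta> z (channel \<Theta> e') = x"
    using L_system_solution_eqI[OF sys z(1) x] by blast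
  then have "L_transfer \<Theta> z e' = e' - 2 * \<i> * cnj (channel \<Theta> 1 x)"
    by (simp add: L_transfer_def K_adj_def)
  moreover have "LF_transfer ?\<Omega> z e =
      e - 2 * \<i> * cnj (channel \<Theta> 1 x + cinner (F_K \<Phi> 1) y)"
    unfolding LF_transfer_def the by (simp add: LF_K_adj_def LF_coupling_def)
  moreover have "cnj (cinner (F_K \<Phi> 1) y) = cadjoint (F_K \<Phi>) y"
    unfolding K by (metis cinner_commute)
  ultimately have "LF_transfer ?\<Omega> z e = L_transfer \<Theta> z e'"
    by (simp only: e'_def complex_cnj_add) (simp only: algebra_simps)
  with y show thesis
    using that unfolding e'_def by blast
qed

lemma equivalent_if_controller_value:
  assumes "L_system \<Theta>" "F_system \<Phi>" "main \<Theta>' = main \<Theta>"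
    and transfer: "\<And>z e. z \<in> L_domain \<Theta> \<Longrightarrow> L_transfer \<Theta>' z e = L_transfer \<Theta> z e * u"
    and controller: "\<And>z y e. F_M \<Phi> y - z *\<^sub>C F_F \<Phi> y = F_K \<Phi> e \<Longrightarrow>
      e - 2 * \<i> * cadjoint (F_K \<Phi>) y = e * u"
  shows "equivalent_L_LF \<Theta>' (LF_coupling \<Theta> \<Phi>)"
  unfolding equivalent_L_LF_def
proof (intro ballI allI)
  fix z e assume "z \<in> L_domain \<Theta>' \<inter> LF_domain (LF_coupling \<Theta> \<Phi>)"
  then have z: "z \<in> L_domain \<Theta>" "z \<in> LF_domain (LF_coupling \<Theta> \<Phi>)"
    using assms(3) by (simp_all add: L_domain_def)
  obtain y where y: "F_M \<Phi> y - z *\<^sub>C F_F \<Phi> y = F_K \<Phi> e"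
    "LF_transfer (LF_coupling \<Theta> \<Phi>) z e = L_transfer \<Theta> z (e - 2 * \<i> * cadjoint (F_K \<Phi>) y)"
    using LF_transfer_factorizes[OF assms(1,2) z] .
  show "L_transfer \<Theta>' z e = LF_transfer (LF_coupling \<Theta> \<Phi>) z e"
    unfolding y(2) controller[OF y(1)] L_transfer_mult[OF assms(1) z(1)] transfer[OF z(1)] ..
qed

text \<open>In terms of sine and cosine, the value of the transfer function is
  \<open>(sin \<alpha> - \<i> cos \<alpha>) / (sin \<alpha> + \<i> cos \<alpha>)\<close>.\<close>

lemma controller_value:
  assumes "cos \<alpha> \<noteq> 0"
    and "F_M (controller \<alpha>) y - z *\<^sub>C F_F (controller \<alpha>) y = F_K (controller \<alpha>) e"
  shows "e - 2 * \<i> * cadjoint (F_K (controller \<alpha>)) y = e * (- exp (2 * \<i> * complex_of_real \<alpha>))"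
proof -
  let ?s = "complex_of_real (sin \<alpha>)" and ?c = "complex_of_real (cos \<alpha>)"
  have K: "cadjoint (\<lambda>e::complex. e) = (\<lambda>y. y)"
    by (rule cadjoint_eqI) simp
  have c: "?c \<noteq> 0"
    using assms(1) by simp
  have e: "e = (complex_of_real (tan \<alpha>) + \<i>) * y"
    using assms(2) by (simp add: controller_def scaleC_complex_def)
  have "exp (2 * \<i> * complex_of_real \<alpha>) = exp (\<i> * \<alpha>) * exp (\<i> * \<alpha>)"
    by (simp add: exp_add[symmetric] algebra_simps)
  also have "exp (\<i> * \<alpha>) = ?c + \<i> * ?s"
    by (simp add: exp_Euler cos_of_real sin_of_real)
  finally have exp2: "exp (2 * \<i> * complex_of_real \<alpha>) = (?c + \<i> * ?s) * (?c + \<i> * ?s)" .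
  have sc: "?s * ?s = 1 - ?c * ?c"
  proof -
    have "sin \<alpha> * sin \<alpha> = 1 - cos \<alpha> * cos \<alpha>"
      using sin_cos_squared_add[of \<alpha>] by (simp add: power2_eq_square)
    then show ?thesis
      by (metis of_real_mult of_real_diff of_real_1)
  qed
  have "(?s + \<i> * ?c) * ((?c + \<i> * ?s) * (?c + \<i> * ?s)) = - (?s - \<i> * ?c) * (?c * ?c + ?s * ?s)"
    by (simp add: algebra_simps)
  then have id: "(?s + \<i> * ?c) * exp (2 * \<i> * complex_of_real \<alpha>) = - (?s - \<i> * ?c)"
    by (simp add: exp2 sc)
  have "e - 2 * \<i> * y = (?s - \<i> * ?c) / ?c * y"
    using c by (simp add: e tan_def field_simps)
  also have "\<dots> = - ((?s + \<i> * ?c) * exp (2 * \<i> * complex_of_real \<alpha>)) / ?c * y"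
    unfolding id by simp
  also have "\<dots> = e * (- exp (2 * \<i> * complex_of_real \<alpha>))"
    using c by (simp add: e tan_def field_simps)
  finally show ?thesis
    by (simp add: controller_def K)
qed

text \<open>The matrix is upper triangular, so the coupled controller acts as the two simple ones in
  succession and the signs of their factors cancel.\<close>

lemma coupled_controller_value:
  assumes "F_M (coupled_controller \<beta> \<gamma>) p - z *\<^sub>C F_F (coupled_controller \<beta> \<gamma>) p =
      F_K (coupled_controller \<beta> \<gamma>) e"
    and "cos \<beta> \<noteq> 0" "cos \<gamma> \<noteq> 0"
  shows "e - 2 * \<i> * cadjoint (F_K (coupled_controller \<beta> \<gamma>)) p =
    e * exp (2 * \<i> * complex_of_real (\<beta> + \<gamma>))"
proof -
  obtain x y where p: "p = (x, y)"
    by (cases p)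
  have K: "cadjoint (\<lambda>e::complex. (e, e)) = (\<lambda>(x, y). x + y)"
    by (rule cadjoint_eqI)
      (auto simp: cinner_complex_def cinner_prod_def algebra_simps split: prod.splits)
  have id: "cadjoint (\<lambda>e::complex. e) = (\<lambda>y. y)"
    by (rule cadjoint_eqI) simp
  have xy: "(complex_of_real (tan \<beta>) + \<i>) * x = e - 2 * \<i> * y"
    "(complex_of_real (tan \<gamma>) + \<i>) * y = e"
    using assms(1) by (auto simp: coupled_controller_def p scaleC_prod_def scaleC_complex_def algebra_simps)
  have "e - 2 * \<i> * y = e * (- exp (2 * \<i> * complex_of_real \<gamma>))"
    using controller_value[OF assms(3), of y 0 e] xy(2)
    by (simp add: controller_def scaleC_complex_def id)
  moreover have "(e - 2 * \<i> * y) - 2 * \<i> * x =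
      (e - 2 * \<i> * y) * (- exp (2 * \<i> * complex_of_real \<beta>))"
    using controller_value[OF assms(2), of x 0 "e - 2 * \<i> * y"] xy(1)
    by (simp add: controller_def scaleC_complex_def id)
  ultimately have "(e - 2 * \<i> * y) - 2 * \<i> * x =
      e * (- exp (2 * \<i> * complex_of_real \<gamma>)) * (- exp (2 * \<i> * complex_of_real \<beta>))"
    by metis
  then have "e - 2 * \<i> * (x + y) =
      e * (exp (2 * \<i> * complex_of_real \<beta>) * exp (2 * \<i> * complex_of_real \<gamma>))"
    by (simp add: algebra_simps)
  then show ?thesis
    by (simp add: coupled_controller_def K p exp_add[symmetric] algebra_simps)
qed

theorem theorem15:
  fixes \<Theta>\<^sub>L :: "'a::complex_hilbert L_array" and \<alpha> :: real
  assumes "minimal_L_system \<Theta>\<^sub>L"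
    and "0 \<le> \<alpha>" and "\<alpha> < pi"
  shows "\<exists>\<Theta>\<^sub>\<alpha> :: 'a L_array.
    unimodular_transformation \<alpha> \<Theta>\<^sub>L \<Theta>\<^sub>\<alpha> \<and>
    (\<alpha> \<noteq> 0 \<and> \<alpha> \<noteq> pi / 2 \<longrightarrow>
      equivalent_L_LF \<Theta>\<^sub>\<alpha> (LF_coupling \<Theta>\<^sub>L (controller \<alpha>))) \<and>
    (\<alpha> = pi / 2 \<longrightarrow>
      equivalent_L_LF \<Theta>\<^sub>\<alpha> (LF_coupling \<Theta>\<^sub>L (coupled_controller (pi / 4) (3 * pi / 4)))) \<and>
    (\<alpha> = 0 \<longrightarrow>
      equivalent_L_LF \<Theta>\<^sub>\<alpha> (LF_coupling \<Theta>\<^sub>L (coupled_controller (3 * pi / 4) (3 * pi / 4))))"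
proof -
  have sys: "L_system \<Theta>\<^sub>L"
    using assms(1) by (simp add: minimal_L_system_def)
  obtain \<Theta>\<^sub>\<alpha> :: "'a L_array" where \<Theta>\<^sub>\<alpha>: "L_system \<Theta>\<^sub>\<alpha>" "main \<Theta>\<^sub>\<alpha> = main \<Theta>\<^sub>L"
    "\<And>z e. z \<in> L_domain \<Theta>\<^sub>L \<Longrightarrow>
      L_transfer \<Theta>\<^sub>\<alpha> z e = L_transfer \<Theta>\<^sub>L z e * (- exp (2 * \<i> * complex_of_real \<alpha>))"
    using unimodular_transformation_exists[OF sys] by blast
  have equiv: "equivalent_L_LF \<Theta>\<^sub>\<alpha> (LF_coupling \<Theta>\<^sub>L \<Phi>)"
    if "F_system \<Phi>"
      and "\<And>z y e. F_M \<Phi> y - z *\<^sub>C F_F \<Phi> y = F_K \<Phi> e \<Longrightarrow>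
        e - 2 * \<i> * cadjoint (F_K \<Phi>) y = e * (- exp (2 * \<i> * complex_of_real \<alpha>))"
    for \<Phi> :: "'h::complex_hilbert F_array"
    by (rule equivalent_if_controller_value[OF sys that(1) \<Theta>\<^sub>\<alpha>(2,3) that(2)])
  have cos4: "cos (pi / 4) \<noteq> 0" "cos (3 * pi / 4) \<noteq> 0"
  proof -
    have "cos (3 * pi / 4) = - cos (pi / 4)"
      using cos_pi_minus[of "pi / 4"] by simp
    then show "cos (pi / 4) \<noteq> 0" "cos (3 * pi / 4) \<noteq> 0"
      by (simp_all add: cos_45)
  qed
  have "unimodular_transformation \<alpha> \<Theta>\<^sub>L \<Theta>\<^sub>\<alpha>"
    using \<Theta>\<^sub>\<alpha>(1,3) by (simp add: unimodular_transformation_def)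
  moreover have "equivalent_L_LF \<Theta>\<^sub>\<alpha> (LF_coupling \<Theta>\<^sub>L (controller \<alpha>))"
    if "\<alpha> \<noteq> 0 \<and> \<alpha> \<noteq> pi / 2"
  proof -
    have "cos \<alpha> \<noteq> 0"
    proof
      assume "cos \<alpha> = 0"
      then show False
        using cos_inj_pi[of \<alpha> "pi / 2"] assms(2,3) that by simp
    qed
    then show ?thesis
      by (intro equiv F_system_controller) (rule controller_value)
  qed
  moreover have "equivalent_L_LF \<Theta>\<^sub>\<alpha> (LF_coupling \<Theta>\<^sub>L (coupled_controller (pi / 4) (3 * pi / 4)))"
    if "\<alpha> = pi / 2"
  proof -
    have "exp (2 * \<i> * complex_of_real (pi / 4 + 3 * pi / 4)) =
        - exp (2 * \<i> * complex_of_real \<alpha>)"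
      using exp_pi_i exp_two_pi_i by (simp add: that mult_ac)
    then show ?thesis
      using coupled_controller_value[OF _ cos4]
      by (intro equiv F_system_coupled_controller) presburger
  qed
  moreover have "equivalent_L_LF \<Theta>\<^sub>\<alpha> (LF_coupling \<Theta>\<^sub>L (coupled_controller (3 * pi / 4) (3 * pi / 4)))"
    if "\<alpha> = 0"
  proof -
    have "2 * \<i> * complex_of_real (3 * pi / 4 + 3 * pi / 4) = 2 * complex_of_real pi * \<i> + pi * \<i>"
      by (simp add: algebra_simps)
    then have "exp (2 * \<i> * complex_of_real (3 * pi / 4 + 3 * pi / 4)) =
        - exp (2 * \<i> * complex_of_real \<alpha>)"
      by (simp only: exp_add exp_two_pi_i exp_pi_i) (simp add: that)
    then show ?thesis
      using coupled_controller_value[OF _ cos4(2) cos4(2)]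
      by (intro equiv F_system_coupled_controller) presburger
  qed
  ultimately show ?thesis
    by blast
qed

end
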